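(* Let ${\mathcal B}$ be a finite family of nonzero elements of $L$. Then ${\mathcal B}$ is $w_S$-semi-reduced if and only if the family $\big(\operatorname{sred}^{w_S(b)}_S(b)\big)_{b\in{\mathcal B}}$ is linearly independent over $k_\mathfrak p$.
   Context: Let $A$ be a Dedekind domain with fraction field $K$, $\mathfrak p$ a nonzero prime ideal with valuation $v_\mathfrak p$, $\pi\in\mathfrak p$ with $v_\mathfrak p(\pi)=1$, $k_\mathfrak p=A/\mathfrak p$. Let $f\in A[x]$ be monic irreducible separable, $\theta$ a root, $L=K(\theta)$, $\mathcal O$ the integral closure of $A$ in $L$, $S=\{\mathfrak P_1,\dots,\mathfrak P_s\}$ the primes of $\mathcal O$ over $\mathfrak p$ with ramification indices $e_i$, normalized valuations $v_{\mathfrak P_i}$, valuation rings $\mathcal O_{(\mathfrak P_i)}$; $w_{\mathfrak P_i}=v_{\mathfrak P_i}/e_i$, $w_S(z)=\min_iw_{\mathfrak P_i}(z)$. For $r\in\mathbb Q$ and $z\in L$ with $w_{\mathfrak P_i}(z)\ge\lfloor r\rfloor$, $\operatorname{sred}^r_{\mathfrak P_i}(z)$ is the class of $\pi^{-\lfloor r\rfloor}z$ in the $k_\mathfrak p$-vector space $\mathcal O_{(\mathfrak P_i)}/\pi\mathcal O_{(\mathfrak P_i)}$ (which the paper identifies with $k_{\mathfrak P_i}^{e_i}$ via the first $e_i$ $\pi_{\mathfrak P_i}$-adic digits), and for $w_S(z)\ge\lfloor r\rfloor$, $\operatorname{sred}^r_S(z):=(\operatorname{sred}^r_{\mathfrak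 P_i}(z))_{1\le i\le s}\in\prod_i\mathcal O_{(\mathfrak P_i)}/\pi\mathcal O_{(\mathfrak P_i)}$. A finite family ${\mathcal B}\subset L$ is $w$-semi-reduced if $\lfloor w(\sum_b\lambda_bb)\rfloor=\min_b\lfloor w(\lambda_bb)\rfloor$ for all $\lambda_b\in K$. *)

theory Defs
  imports "HOL-Computational_Algebra.Polynomial" "HOL-Library.Extended_Real"
begin

text \<open>All rings live inside one ambient field of type 'l, which plays the role of L.
  A subring A of 'l is the Dedekind domain, its fraction field K is realised inside 'l.\<close>

definition subring_in :: "'l::field set \<Rightarrow> bool" where
  "subring_in A \<longleftrightarrow> 0 \<in> A \<and> 1 \<in> A \<and>
     (\<forall>x\<in>A. \<forall>y\<in>A. x + y \<in> A \<and> x - y \<in> A \<and> x * y \<in> A)"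

definition frac_field :: "'l::field set \<Rightarrow> 'l set" where
  "frac_field A = {a / c | a c. a \<in> A \<and> c \<in> A \<and> c \<noteq> 0}"

definition ideal_in :: "'l::field set \<Rightarrow> 'l set \<Rightarrow> bool" where
  "ideal_in R I \<longleftrightarrow> I \<subseteq> R \<and> 0 \<in> I \<and>
     (\<forall>x\<in>I. \<forall>y\<in>I. x + y \<in> I) \<and> (\<forall>r\<in>R. \<forall>x\<in>I. r * x \<in> I)"

definition prime_ideal_in :: "'l::field set \<Rightarrow> 'l set \<Rightarrow> bool" where
  "prime_ideal_in R P \<longleftrightarrow> ideal_in R P \<and> P \<noteq> R \<and>
     (\<forall>x\<in>R. \<forall>y\<in>R. x * y \<in> P \<longrightarrow> x \<in> P \<or> y \<in> P)"

definition maximal_ideal_in :: "'l::field set \<Rightarrow> 'l set \<Rightarrow> bool" where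
  "maximal_ideal_in R M \<longleftrightarrow> ideal_in R M \<and> M \<noteq> R \<and>
     (\<forall>J. ideal_in R J \<and> M \<subseteq> J \<longrightarrow> J = M \<or> J = R)"

definition ideal_gen :: "'l::field set \<Rightarrow> 'l set \<Rightarrow> 'l set" where
  "ideal_gen R G = \<Inter>{J. ideal_in R J \<and> G \<subseteq> J}"

definition noetherian_ring :: "'l::field set \<Rightarrow> bool" where
  "noetherian_ring R \<longleftrightarrow>
     (\<forall>I. ideal_in R I \<longrightarrow> (\<exists>G. finite G \<and> G \<subseteq> I \<and> I = ideal_gen R G))"

definition integral_over :: "'l::field set \<Rightarrow> 'l \<Rightarrow> bool" where
  "integral_over R z \<longleftrightarrow>
     (\<exists>q::'l poly. lead_coeff q = 1 \<and> (\<forall>i. coeff q i \<in> R) \<and> poly q z = 0)"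

definition dedekind_domain :: "'l::field set \<Rightarrow> bool" where
  "dedekind_domain A \<longleftrightarrow> subring_in A \<and> noetherian_ring A \<and>
     (\<forall>z\<in>frac_field A. integral_over A z \<longrightarrow> z \<in> A) \<and>
     (\<forall>P. prime_ideal_in A P \<and> P \<noteq> {0} \<longrightarrow> maximal_ideal_in A P)"

definition int_closure :: "'l::field set \<Rightarrow> 'l set" where
  "int_closure A = {z. integral_over A z}"

definition ideal_mult :: "'l::field set \<Rightarrow> 'l set \<Rightarrow> 'l set \<Rightarrow> 'l set" where
  "ideal_mult R I J = ideal_gen R {x * y | x y. x \<in> I \<and> y \<in> J}"

primrec ideal_pow :: "'l::field set \<Rightarrow> 'l set \<Rightarrow> nat \<Rightarrow> 'l set" where
  "ideal_pow R I 0 = R"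
| "ideal_pow R I (Suc n) = ideal_mult R I (ideal_pow R I n)"

definition primes_over :: "'l::field set \<Rightarrow> 'l set \<Rightarrow> 'l set \<Rightarrow> 'l set set" where
  "primes_over A Ob p = {P. prime_ideal_in Ob P \<and> P \<inter> A = p}"

definition ord_in :: "'l::field set \<Rightarrow> 'l set \<Rightarrow> 'l \<Rightarrow> nat" where
  "ord_in Ob P a = (GREATEST n. a \<in> ideal_pow Ob P n)"

definition val_P :: "'l::field set \<Rightarrow> 'l set \<Rightarrow> 'l \<Rightarrow> int" where
  "val_P Ob P z = (let (a, c) = (SOME (a, c). a \<in> Ob \<and> c \<in> Ob \<and> a \<noteq> 0 \<and> c \<noteq> 0 \<and> z = a / c)
                  in int (ord_in Ob P a) - int (ord_in Ob P c))"

definition ram_index :: "'l::field set \<Rightarrow> 'l set \<Rightarrow> 'l set \<Rightarrow> nat" where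
  "ram_index Ob p P = (GREATEST n. p \<subseteq> ideal_pow Ob P n)"

definition w_P :: "'l::field set \<Rightarrow> 'l set \<Rightarrow> 'l set \<Rightarrow> 'l \<Rightarrow> ereal" where
  "w_P Ob p P z = (if z = 0 then \<infinity>
                  else ereal (real_of_int (val_P Ob P z) / real (ram_index Ob p P)))"

definition w_S :: "'l::field set \<Rightarrow> 'l set \<Rightarrow> 'l set \<Rightarrow> 'l \<Rightarrow> ereal" where
  "w_S A Ob p z = (INF P\<in>primes_over A Ob p. w_P Ob p P z)"

definition efloor :: "ereal \<Rightarrow> ereal" where
  "efloor x = (case x of ereal r \<Rightarrow> ereal (real_of_int \<lfloor>r\<rfloor>) | PInfty \<Rightarrow> \<infinity> | MInfty \<Rightarrow> -\<infinity>)"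

definition semi_reduced :: "'l::field set \<Rightarrow> ('l \<Rightarrow> ereal) \<Rightarrow> 'i set \<Rightarrow> ('i \<Rightarrow> 'l) \<Rightarrow> bool" where
  "semi_reduced K w I b \<longleftrightarrow>
     (\<forall>c. (\<forall>i\<in>I. c i \<in> K) \<longrightarrow>
        efloor (w (\<Sum>i\<in>I. c i * b i)) = (INF i\<in>I. efloor (w (c i * b i))))"

definition loc_at :: "'l::field set \<Rightarrow> 'l set \<Rightarrow> 'l set" where
  "loc_at Ob P = {a / c | a c. a \<in> Ob \<and> c \<in> Ob \<and> c \<notin> P}"

definition scaled :: "'l::field \<Rightarrow> 'l set \<Rightarrow> 'l set" where
  "scaled \<pi> M = {\<pi> * y | y. y \<in> M}"

text \<open>Linear independence over k_p = A/p of the family of S-reductions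
  sred^{r_i}_S(b i) = (class of pi^(-floor r_i) * b i in O_(P)/pi O_(P))_{P in S},
  with r_i = w_S(b i).  Written out: a k_p-combination with coefficients
  [lambda i] (lambda i in A) vanishes in the product of the quotients iff
  sum_i lambda i * pi^(-floor r_i) * b i lies in pi O_(P) for every P in S;
  a coefficient [lambda i] is zero in k_p iff lambda i is in p.\<close>
definition sred_lin_indep ::
  "'l::field set \<Rightarrow> 'l set \<Rightarrow> 'l set \<Rightarrow> 'l \<Rightarrow> 'i set \<Rightarrow> ('i \<Rightarrow> 'l) \<Rightarrow> bool" where
  "sred_lin_indep A Ob p \<pi> I b \<longleftrightarrow>
     (\<forall>c. (\<forall>i\<in>I. c i \<in> A) \<longrightarrow>
        (\<forall>P\<in>primes_over A Ob p.
            (\<Sum>i\<in>I. c i * (\<pi> powi (- \<lfloor>real_of_ereal (w_S A Ob p (b i))\<rfloor>)) * b i)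
              \<in> scaled \<pi> (loc_at Ob P)) \<longrightarrow>
        (\<forall>i\<in>I. c i \<in> p))"

end

(* The integral closure need not be shown to be noetherian.  Any n + 1 elements of L, n the degree
   of f, satisfy a linear relation with coefficients in the discrete valuation ring A_p, one of
   which is 1.  This bounds chains of ideals above pi in the localization V_P of the integral
   closure at a prime P over p, and makes elements stabilizing its maximal ideal integral; hence V_P
   is a discrete valuation ring, and floor (w_S z) >= k iff pi^(-k) z lies in V_P for all P.
   A relation violating one of the two conditions then turns into one violating the other, by scaling
   the i-th coefficient by a power of pi and clearing denominators prime to p. *)
theory Submission
  imports Defs "Jordan_Normal_Form.Char_Poly"
begin

text \<open>\<open>val_P\<close> and \<open>ram_index\<close> are built from a fraction chosen by
  \<open>SOME\<close> and from \<open>GREATEST\<close> over powers of ideals; they can be evaluated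
  only once each localization V is known to be a discrete valuation ring. The criterion behind this
  is run twice: find y outside aV with yM inside aV. Over A_p, generators of p yield both y and the
  integrality of y / a; over P, the relations with coefficients in A_p take the place of generators.
  If z = t^m u and \<pi> = t^e w with units u, w, then w_P z \<ge> k reads k e \<le> m: the division
  by e in w_P makes integral bounds at all P expressible by powers of the single element \<pi>, and
  this is why both conditions involve floors. Multiplying b_i by \<pi>^(-k_i), with k_i the floor of
  its w_S, brings the floor to 0, so a coefficient of K that keeps the product at level 0 lies in
  A_p, and a coefficient of A outside p is a unit there. Linear independence speaks of one level
  only, so an arbitrary bound is reached by raising a common bound of all terms one unit at a
  time.\<close>

lemma subring_inD:
  assumes "subring_in R"
  shows "0 \<in> R" "1 \<in> R" "\<And>x y. x \<in> R \<Longrightarrow> y \<in> R \<Longrightarrow> x + y \<in> R"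
    "\<And>x y. x \<in> R \<Longrightarrow> y \<in> R \<Longrightarrow> x - y \<in> R" "\<And>x y. x \<in> R \<Longrightarrow> y \<in> R \<Longrightarrow> x * y \<in> R"
    "\<And>x. x \<in> R \<Longrightarrow> - x \<in> R" "\<And>x n. x \<in> R \<Longrightarrow> x ^ n \<in> R"
proof -
  show *: "0 \<in> R" "1 \<in> R" "\<And>x y. x \<in> R \<Longrightarrow> y \<in> R \<Longrightarrow> x + y \<in> R"
    "\<And>x y. x \<in> R \<Longrightarrow> y \<in> R \<Longrightarrow> x - y \<in> R" "\<And>x y. x \<in> R \<Longrightarrow> y \<in> R \<Longrightarrow> x * y \<in> R"
    using assms by (auto simp: subring_in_def)
  show "\<And>x. x \<in> R \<Longrightarrow> - x \<in> R" using *(1,4) by fastforce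
  show "x ^ n \<in> R" if "x \<in> R" for x n
    using * that by (induction n) auto
qed

lemma subring_in_sum:
  assumes "subring_in R" "\<And>i. i \<in> S \<Longrightarrow> f i \<in> R"
  shows "sum f S \<in> R"
  using assms(2) by (induction S rule: infinite_finite_induct) (auto simp: subring_inD[OF assms(1)])

lemma ideal_inD:
  assumes "ideal_in R J"
  shows "J \<subseteq> R" "0 \<in> J" "\<And>x y. x \<in> J \<Longrightarrow> y \<in> J \<Longrightarrow> x + y \<in> J"
    "\<And>r x. r \<in> R \<Longrightarrow> x \<in> J \<Longrightarrow> r * x \<in> J" "\<And>r x. r \<in> R \<Longrightarrow> x \<in> J \<Longrightarrow> x * r \<in> J"
  using assms by (auto simp: ideal_in_def mult.commute)

lemma ideal_in_diff:
  assumes "subring_in R" "ideal_in R J" "x \<in> J" "y \<in> J"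
  shows "x - y \<in> J"
proof -
  have "(-1) * y \<in> J" by (intro ideal_inD(4)[OF assms(2)] assms subring_inD[OF assms(1)])
  then show ?thesis using ideal_inD(3)[OF assms(2) assms(3), of "- y"] by simp
qed

lemma ideal_in_sum:
  assumes "ideal_in R J" "\<And>i. i \<in> S \<Longrightarrow> f i \<in> J"
  shows "sum f S \<in> J"
  using assms(2) by (induction S rule: infinite_finite_induct) (auto simp: ideal_inD[OF assms(1)])

subsection \<open>Integral elements\<close>

text \<open>The polynomials with coefficients in R are closed under sums and products, and the
  Leibniz formula builds the characteristic polynomial from such entries and signs.\<close>

lemma char_poly_coeff_in_subring:
  assumes R: "subring_in R" and M: "M \<in> carrier_mat n n"
    and entries: "\<And>i j. i < n \<Longrightarrow> j < n \<Longrightarrow> M $$ (i, j) \<in> R"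
  shows "coeff (char_poly M) k \<in> R"
proof -
  define Q where "Q = {q. \<forall>k. coeff q k \<in> R}"
  have sQ: "sum f S \<in> Q" if "\<And>i. i \<in> S \<Longrightarrow> f i \<in> Q" for f :: "'b \<Rightarrow> 'a poly" and S
    using that by (auto simp: Q_def coeff_sum intro!: subring_in_sum[OF R])
  have mQ: "q * r \<in> Q" if "q \<in> Q" "r \<in> Q" for q r
    using that by (auto simp: Q_def coeff_mult intro!: subring_in_sum[OF R] subring_inD[OF R])
  have oQ: "1 \<in> Q" "-1 \<in> Q"
    using subring_inD[OF R] by (auto simp: Q_def coeff_pCons one_pCons split: nat.split)
  have pQ: "prod f S \<in> Q" if "\<And>i. i \<in> S \<Longrightarrow> f i \<in> Q" for f :: "'b \<Rightarrow> 'a poly" and S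
    using that by (induction S rule: infinite_finite_induct) (auto simp: oQ mQ)
  have entry: "char_poly_matrix M $$ (i, j) \<in> Q" if "i < n" "j < n" for i j
    using that M entries[OF that] subring_inD[OF R]
    by (auto simp: Q_def char_poly_matrix_def coeff_pCons split: nat.split)
  have "char_poly M \<in> Q"
    unfolding char_poly_def det_def'[OF char_poly_matrix_closed[OF M]]
  proof (intro sQ mQ pQ)
    fix \<sigma> assume "\<sigma> \<in> {\<sigma>. \<sigma> permutes {0..<n}}"
    then have \<sigma>: "\<sigma> permutes {0..<n}" by simp
    show "signof \<sigma> \<in> Q" using oQ by (auto simp: sign_def)
    fix i assume i: "i \<in> {0..<n}"
    show "char_poly_matrix M $$ (i, \<sigma> i) \<in> Q"
      using entry[of i "\<sigma> i"] i permutes_in_image[OF \<sigma>, of i] by auto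
  qed
  then show ?thesis by (simp add: Q_def)
qed

section \<open>Finitely generated modules and integrality\<close>

text \<open>The elements of G serve as their own indices. The definition is meant for finite G: over
  an infinite G every such sum defaults to 0.\<close>

definition rspan :: "'l::field set \<Rightarrow> 'l set \<Rightarrow> 'l set" where
  "rspan R G = {\<Sum>g\<in>G. r g * g | r. \<forall>g\<in>G. r g \<in> R}"

lemma rspanI: "(\<And>g. g \<in> G \<Longrightarrow> r g \<in> R) \<Longrightarrow> (\<Sum>g\<in>G. r g * g) \<in> rspan R G"
  unfolding rspan_def by blast

lemma rspan_add:
  assumes "subring_in R" "x \<in> rspan R G" "y \<in> rspan R G"
  shows "x + y \<in> rspan R G"
proof -
  obtain r s where "x = (\<Sum>g\<in>G. r g * g)" "y = (\<Sum>g\<in>G. s g * g)"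
    and rs: "\<forall>g\<in>G. r g \<in> R" "\<forall>g\<in>G. s g \<in> R"
    using assms by (auto simp: rspan_def)
  then have "x + y = (\<Sum>g\<in>G. (r g + s g) * g)" by (simp add: sum.distrib algebra_simps)
  then show ?thesis using rspanI[of G "\<lambda>g. r g + s g"] rs subring_inD[OF assms(1)] by auto
qed

lemma rspan_scale:
  assumes "subring_in R" "c \<in> R" "x \<in> rspan R G"
  shows "c * x \<in> rspan R G"
proof -
  obtain r where "x = (\<Sum>g\<in>G. r g * g)" and r: "\<forall>g\<in>G. r g \<in> R"
    using assms by (auto simp: rspan_def)
  then have "c * x = (\<Sum>g\<in>G. (c * r g) * g)" by (simp add: sum_distrib_left algebra_simps)
  then show ?thesis using rspanI[of G "\<lambda>g. c * r g"] r assms(2) subring_inD[OF assms(1)] by auto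
qed

lemma rspan_zero: "subring_in R \<Longrightarrow> 0 \<in> rspan R G"
  using rspanI[of G "\<lambda>_. 0" R] by (auto simp: subring_inD)

lemma rspan_sum:
  assumes "subring_in R" "\<And>i. i \<in> S \<Longrightarrow> f i \<in> rspan R G"
  shows "sum f S \<in> rspan R G"
  using assms(2) by (induction S rule: infinite_finite_induct)
    (auto simp: rspan_zero rspan_add assms(1))

lemma rspan_generator:
  assumes "subring_in R" "finite G" "g \<in> G"
  shows "g \<in> rspan R G"
proof -
  have "(\<Sum>h\<in>G. (if h = g then 1 else 0) * h) = g"
    using assms by (simp add: sum.delta if_distrib[of "\<lambda>x. x * _"] cong: if_cong)
  moreover have "(\<Sum>h\<in>G. (if h = g then 1 else 0) * h) \<in> rspan R G"
    by (rule rspanI) (auto simp: subring_inD[OF assms(1)])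
  ultimately show ?thesis by simp
qed

lemma rspan_map:
  assumes "subring_in R" "\<And>g. g \<in> G \<Longrightarrow> x * g \<in> rspan R H" "y \<in> rspan R G"
  shows "x * y \<in> rspan R H"
proof -
  obtain r where y: "y = (\<Sum>g\<in>G. r g * g)" and r: "\<forall>g\<in>G. r g \<in> R"
    using assms by (auto simp: rspan_def)
  have "x * y = (\<Sum>g\<in>G. r g * (x * g))" by (simp add: y sum_distrib_left algebra_simps)
  then show ?thesis using r by (auto intro!: rspan_sum rspan_scale assms)
qed

lemma rspan_mono: "R \<subseteq> R' \<Longrightarrow> rspan R G \<subseteq> rspan R' G"
  unfolding rspan_def by blast

text \<open>Multiplication by z acts on the generators through a matrix over R, so the vector of
  generators is an eigenvector for z, nonzero because of \<open>g0\<close>. Hence z is a root of the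
  monic characteristic polynomial.\<close>

lemma integral_over_of_stable:
  assumes R: "subring_in R" and G: "finite G" "g0 \<in> G" "g0 \<noteq> 0"
    and stable: "\<And>g. g \<in> G \<Longrightarrow> z * g \<in> rspan R G"
  shows "integral_over R z"
proof -
  define n where "n = card G"
  obtain h where h: "bij_betw h {0..<n} G"
    using ex_bij_betw_nat_finite[OF G(1)] n_def by blast
  have "\<forall>g\<in>G. \<exists>r. (\<forall>g'\<in>G. r g' \<in> R) \<and> z * g = (\<Sum>g'\<in>G. r g' * g')"
    using stable by (auto simp: rspan_def)
  then obtain r where r: "\<And>g g'. g \<in> G \<Longrightarrow> g' \<in> G \<Longrightarrow> r g g' \<in> R"
    and zr: "\<And>g. g \<in> G \<Longrightarrow> z * g = (\<Sum>g'\<in>G. r g g' * g')" by metis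
  have hG: "i < n \<Longrightarrow> h i \<in> G" for i using h by (auto simp: bij_betw_def)
  define M where "M = mat n n (\<lambda>(i, j). r (h i) (h j))"
  have M: "M \<in> carrier_mat n n" by (simp add: M_def)
  define v where "v = vec n h"
  obtain i0 where i0: "i0 < n" "h i0 = g0" using h G(2) by (auto simp: bij_betw_def)
  have "eigenvector M v z"
    unfolding eigenvector_def
  proof (intro conjI)
    show "v \<in> carrier_vec (dim_row M)" by (simp add: v_def M_def)
    have "v $ i0 \<noteq> 0\<^sub>v (dim_row M) $ i0" using i0 G(3) by (simp add: v_def M_def)
    then show "v \<noteq> 0\<^sub>v (dim_row M)" by auto
    show "M *\<^sub>v v = z \<cdot>\<^sub>v v"
    proof (rule eq_vecI)
      show "dim_vec (M *\<^sub>v v) = dim_vec (z \<cdot>\<^sub>v v)" by (simp add: M_def v_def)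
      fix i assume "i < dim_vec (z \<cdot>\<^sub>v v)"
      then have i: "i < n" by (simp add: v_def)
      have "(M *\<^sub>v v) $ i = (\<Sum>j\<in>{0..<n}. r (h i) (h j) * h j)"
        using i by (simp add: M_def v_def scalar_prod_def)
      also have "\<dots> = (\<Sum>g'\<in>G. r (h i) g' * g')"
        by (rule sum.reindex_bij_betw[OF h, of "\<lambda>g'. r (h i) g' * g'"])
      also have "\<dots> = (z \<cdot>\<^sub>v v) $ i" using i hG zr by (simp add: v_def)
      finally show "(M *\<^sub>v v) $ i = (z \<cdot>\<^sub>v v) $ i" .
    qed
  qed
  then have "eigenvalue M z" by (auto simp: eigenvalue_def)
  then have "poly (char_poly M) z = 0" using eigenvalue_root_char_poly[OF M] by simp
  moreover have "lead_coeff (char_poly M) = 1" using degree_monic_char_poly[OF M] by simp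
  moreover have "coeff (char_poly M) k \<in> R" for k
    by (rule char_poly_coeff_in_subring[OF R M]) (auto simp: M_def r hG)
  ultimately show ?thesis by (auto simp: integral_over_def)
qed

text \<open>The equation for the top power is the form in which integrality is produced and used
  below. The case d = 0 would say 1 = 0, so it does no harm.\<close>

lemma integral_over_iff:
  assumes R: "subring_in R"
  shows "integral_over R z \<longleftrightarrow> (\<exists>d c. (\<forall>i<d. c i \<in> R) \<and> z ^ d = (\<Sum>i<d. c i * z ^ i))"
proof
  assume "integral_over R z"
  then obtain q where q: "lead_coeff q = 1" "\<And>i. coeff q i \<in> R" "poly q z = 0"
    by (auto simp: integral_over_def)
  have "(\<Sum>i<degree q. coeff q i * z ^ i) + z ^ degree q = 0"
    using q(1,3) by (simp add: poly_altdef lessThan_Suc_atMost[symmetric])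
  then have "z ^ degree q = (\<Sum>i<degree q. (- coeff q i) * z ^ i)"
    by (simp add: sum_negf eq_neg_iff_add_eq_0 add.commute)
  then show "\<exists>d c. (\<forall>i<d. c i \<in> R) \<and> z ^ d = (\<Sum>i<d. c i * z ^ i)"
    using q(2) subring_inD(6)[OF R]
    by (intro exI[of _ "degree q"] exI[of _ "\<lambda>i. - coeff q i"]) auto
next
  assume "\<exists>d c. (\<forall>i<d. c i \<in> R) \<and> z ^ d = (\<Sum>i<d. c i * z ^ i)"
  then obtain d c where c: "\<And>i. i < d \<Longrightarrow> c i \<in> R" and z: "z ^ d = (\<Sum>i<d. c i * z ^ i)" by blast
  define q where "q = monom 1 d - (\<Sum>i<d. monom (c i) i)"
  have cf: "coeff q i = (if i = d then 1 else if i < d then - c i else 0)" for i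
    by (auto simp: q_def coeff_sum coeff_monom sum.delta)
  have "degree q = d"
    by (rule antisym) (auto intro!: degree_le le_degree simp: cf)
  then have "lead_coeff q = 1" by (simp add: cf)
  moreover have "coeff q i \<in> R" for i using c subring_inD[OF R] by (auto simp: cf)
  moreover have "poly q z = 0" by (simp add: q_def poly_sum poly_monom z)
  ultimately show "integral_over R z" by (auto simp: integral_over_def)
qed

lemma integral_over_self:
  assumes "subring_in R" "x \<in> R"
  shows "integral_over R x"
proof -
  have "x ^ 1 = (\<Sum>i<1. x * x ^ i)" by simp
  then show ?thesis unfolding integral_over_iff[OF assms(1)] using assms(2)
    by (intro exI[of _ 1] exI[of _ "\<lambda>_. x"]) auto
qed

text \<open>For fixed G the elements with this property are closed under sums and products, unlike
  integral equations, which do not combine directly.\<close>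

definition stabilizes :: "'l::field set \<Rightarrow> 'l set \<Rightarrow> 'l \<Rightarrow> bool" where
  "stabilizes R G x \<longleftrightarrow> (\<forall>g\<in>G. x * g \<in> rspan R G)"

text \<open>Enlarge G by the products with 1, x, ..., x^(d-1); the equation brings x^d back down.
  The coefficients only have to stabilize the span of G, not lie in R, so the lemma serves both
  adjunction of an integral element and transitivity of integrality.\<close>

lemma stabilizes_extend:
  assumes R: "subring_in R" and G: "finite G" "1 \<in> G"
    and c: "\<And>i. i < d \<Longrightarrow> stabilizes R G (c i)" and x: "x ^ d = (\<Sum>i<d. c i * x ^ i)"
  obtains H where "finite H" "1 \<in> H" "stabilizes R H x"
    "\<And>y. stabilizes R G y \<Longrightarrow> stabilizes R H y"
proof
  define H where "H = (\<lambda>(i, g). x ^ i * g) ` ({..<d} \<times> G)"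
  \<comment> \<open>An empty right-hand side would give 1 = 0.\<close>
  have "d \<noteq> 0" using x by (metis lessThan_0 power_0 sum.empty zero_neq_one)
  then have d: "0 < d" by simp
  show fH: "finite H" using G by (simp add: H_def)
  have HI: "x ^ i * g \<in> H" if "i < d" "g \<in> G" for i g
    using that by (auto simp: H_def)
  show "1 \<in> H" using HI[of 0 1] d G by simp
  have lift: "x ^ i * y \<in> rspan R H" if "i < d" "y \<in> rspan R G" for i y
    by (rule rspan_map[OF R _ that(2)]) (auto intro!: rspan_generator[OF R fH] HI that(1))
  show "stabilizes R H x" unfolding stabilizes_def
  proof
    fix h assume "h \<in> H"
    then obtain i g where h: "h = x ^ i * g" "i < d" "g \<in> G" by (auto simp: H_def)
    show "x * h \<in> rspan R H"
    proof (cases "Suc i < d")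
      case True
      then have "x ^ Suc i * g \<in> rspan R H" using h by (intro rspan_generator[OF R fH] HI)
      then show ?thesis by (simp add: h mult.assoc)
    next
      case False
      then have "Suc i = d" using h by simp
      then have "x * h = x ^ d * g" by (auto simp: h)
      also have "\<dots> = (\<Sum>i<d. x ^ i * (c i * g))" by (simp add: x sum_distrib_left sum_distrib_right mult_ac)
      also have "\<dots> \<in> rspan R H"
        using c h(3) by (intro rspan_sum[OF R] lift) (auto simp: stabilizes_def)
      finally show ?thesis .
    qed
  qed
  show "stabilizes R H y" if "stabilizes R G y" for y unfolding stabilizes_def
  proof
    fix h assume "h \<in> H"
    then obtain i g where h: "h = x ^ i * g" "i < d" "g \<in> G" by (auto simp: H_def)
    have "x ^ i * (y * g) \<in> rspan R H" using h that by (intro lift) (auto simp: stabilizes_def)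
    then show "y * h \<in> rspan R H" by (simp add: h algebra_simps)
  qed
qed

lemma stabilizes_scalar: "subring_in R \<Longrightarrow> finite G \<Longrightarrow> x \<in> R \<Longrightarrow> stabilizes R G x"
  using rspan_scale rspan_generator by (fastforce simp: stabilizes_def)

lemma ex_stabilized_by_integral:
  assumes R: "subring_in R" and "finite X" "\<And>x. x \<in> X \<Longrightarrow> integral_over R x"
  shows "\<exists>G. finite G \<and> 1 \<in> G \<and> (\<forall>x\<in>X. stabilizes R G x)"
  using assms(2,3)
proof (induction X)
  case empty
  then show ?case by (intro exI[of _ "{1}"]) auto
next
  case (insert x X)
  then obtain G where G: "finite G" "1 \<in> G" "\<forall>x\<in>X. stabilizes R G x" by auto
  obtain d c where c: "\<And>i. i < d \<Longrightarrow> c i \<in> R" and x: "x ^ d = (\<Sum>i<d. c i * x ^ i)"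
    using insert.prems[of x] by (auto simp: integral_over_iff[OF R])
  obtain H where "finite H" "1 \<in> H" "stabilizes R H x"
    "\<And>y. stabilizes R G y \<Longrightarrow> stabilizes R H y"
    using stabilizes_extend[OF R G(1,2) _ x] stabilizes_scalar[OF R G(1) c] by blast
  then show ?case using G(3) by (intro exI[of _ H]) auto
qed

lemma stabilizes_imp_integral:
  "subring_in R \<Longrightarrow> finite G \<Longrightarrow> 1 \<in> G \<Longrightarrow> stabilizes R G x \<Longrightarrow> integral_over R x"
  by (rule integral_over_of_stable[of R G 1]) (auto simp: stabilizes_def)

lemma subring_int_closure:
  assumes R: "subring_in R"
  shows "subring_in (int_closure R)"
proof -
  have "integral_over R (x + y) \<and> integral_over R (x - y) \<and> integral_over R (x * y)"
    if "integral_over R x" "integral_over R y" for x y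
  proof -
    have "\<exists>G. finite G \<and> 1 \<in> G \<and> (\<forall>u\<in>{x, y}. stabilizes R G u)"
      by (rule ex_stabilized_by_integral[OF R]) (use that in auto)
    then obtain G where G: "finite G" "1 \<in> G" and st: "stabilizes R G x" "stabilizes R G y"
      by (metis insertI1 insertI2)
    have st1: "stabilizes R G (x + y)"
      using st rspan_add[OF R] by (auto simp: stabilizes_def distrib_right)
    have st2: "stabilizes R G (x * y)"
      using st rspan_map[OF R, of G x G] by (auto simp: stabilizes_def mult.assoc)
    have st3: "stabilizes R G (x - y)"
      unfolding stabilizes_def
    proof
      fix g assume "g \<in> G"
      then have "x * g + (-1) * (y * g) \<in> rspan R G"
        using st subring_inD[OF R]
        by (intro rspan_add[OF R] rspan_scale[OF R, of "-1"]) (auto simp: stabilizes_def)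
      then show "(x - y) * g \<in> rspan R G" by (simp add: algebra_simps)
    qed
    show ?thesis using stabilizes_imp_integral[OF R G] st1 st2 st3 by blast
  qed
  moreover have "integral_over R 0" "integral_over R 1"
    using subring_inD[OF R] by (auto intro: integral_over_self[OF R])
  ultimately show ?thesis
    unfolding subring_in_def int_closure_def by blast
qed

text \<open>The finitely many coefficients of an equation for z stabilize a common module, which the
  powers of z enlarge to one that z stabilizes.\<close>

lemma integral_over_int_closure:
  assumes R: "subring_in R" and z: "integral_over (int_closure R) z"
  shows "integral_over R z"
proof -
  obtain d c where c: "\<And>i. i < d \<Longrightarrow> integral_over R (c i)" and x: "z ^ d = (\<Sum>i<d. c i * z ^ i)"
    using z[unfolded integral_over_iff[OF subring_int_closure[OF R]]]
    by (auto simp only: int_closure_def mem_Collect_eq)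
  have "\<exists>G. finite G \<and> 1 \<in> G \<and> (\<forall>x\<in>c ` {..<d}. stabilizes R G x)"
    by (rule ex_stabilized_by_integral[OF R]) (use c in auto)
  then obtain G where G: "finite G" "1 \<in> G" "\<forall>x\<in>c ` {..<d}. stabilizes R G x" by metis
  obtain H where "finite H" "1 \<in> H" "stabilizes R H z"
    using stabilizes_extend[OF R G(1,2) _ x] G(3) by (metis image_eqI lessThan_iff)
  then show ?thesis using stabilizes_imp_integral[OF R] by blast
qed

subsection \<open>Localization at a prime\<close>

lemma prime_ideal_inD:
  assumes "prime_ideal_in R Q"
  shows "ideal_in R Q" "Q \<noteq> R" "\<And>x y. x \<in> R \<Longrightarrow> y \<in> R \<Longrightarrow> x * y \<in> Q \<Longrightarrow> x \<in> Q \<or> y \<in> Q"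
  using assms by (auto simp: prime_ideal_in_def)

lemma one_notin_ideal:
  assumes "ideal_in R J" "J \<noteq> R"
  shows "1 \<notin> J"
  using ideal_inD(1)[OF assms(1)] ideal_inD(4)[OF assms(1), of _ 1] assms(2) by auto

text \<open>The extension of Q to \<open>loc_at R Q\<close>. That it is the unique maximal ideal is
  the content of \<open>unit_or_max\<close> and \<open>one_notin_max\<close>.\<close>

definition loc_max :: "'l::field set \<Rightarrow> 'l set \<Rightarrow> 'l set" where
  "loc_max R Q = {a / c | a c. a \<in> Q \<and> c \<in> R \<and> c \<notin> Q}"

locale localization =
  fixes R Q :: "'l::field set"
  assumes subring: "subring_in R" and prime: "prime_ideal_in R Q"
begin

abbreviation "V \<equiv> loc_at R Q"
abbreviation "M \<equiv> loc_max R Q"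

lemmas R = subring_inD[OF subring]
lemmas Q = ideal_inD[OF prime_ideal_inD(1)[OF prime]]

lemma one_notin: "1 \<notin> Q"
  using one_notin_ideal prime_ideal_inD[OF prime] by blast

lemma compl_nonzero: "c \<notin> Q \<Longrightarrow> c \<noteq> 0"
  using Q(2) by auto

lemma compl_mult: "c \<in> R \<Longrightarrow> d \<in> R \<Longrightarrow> c \<notin> Q \<Longrightarrow> d \<notin> Q \<Longrightarrow> c * d \<notin> Q"
  using prime_ideal_inD(3)[OF prime] by blast

lemma locI: "a \<in> R \<Longrightarrow> c \<in> R \<Longrightarrow> c \<notin> Q \<Longrightarrow> a / c \<in> V"
  by (auto simp: loc_at_def)

lemma locE:
  assumes "x \<in> V"
  obtains a c where "a \<in> R" "c \<in> R" "c \<notin> Q" "c \<noteq> 0" "x = a / c"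
  using assms compl_nonzero by (auto simp: loc_at_def)

lemma maxI: "a \<in> Q \<Longrightarrow> c \<in> R \<Longrightarrow> c \<notin> Q \<Longrightarrow> a / c \<in> M"
  by (auto simp: loc_max_def)

lemma maxE:
  assumes "x \<in> M"
  obtains a c where "a \<in> Q" "c \<in> R" "c \<notin> Q" "c \<noteq> 0" "x = a / c"
  using assms compl_nonzero by (auto simp: loc_max_def)

lemma base_sub: "x \<in> R \<Longrightarrow> x \<in> V"
  using locI[of x 1] R one_notin by simp

lemma inverse_compl: "c \<in> R \<Longrightarrow> c \<notin> Q \<Longrightarrow> inverse c \<in> V"
  using locI[of 1 c] R by (simp add: inverse_eq_divide)

lemma subring_loc: "subring_in V"
  unfolding subring_in_def
proof (intro conjI ballI)
  fix x y assume "x \<in> V" "y \<in> V"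
  then obtain a c b d where x: "a \<in> R" "c \<in> R" "c \<notin> Q" "c \<noteq> 0" "x = a / c"
    and y: "b \<in> R" "d \<in> R" "d \<notin> Q" "d \<noteq> 0" "y = b / d"
    by (metis locE)
  have cd: "c * d \<in> R" "c * d \<notin> Q" using x y R compl_mult by auto
  have "x + y = (a * d + b * c) / (c * d)" "x - y = (a * d - b * c) / (c * d)"
    "x * y = (a * b) / (c * d)"
    using x y by (auto simp: field_simps)
  then show "x + y \<in> V" "x - y \<in> V" "x * y \<in> V"
    using x y cd R by (auto intro!: locI)
qed (use base_sub R in auto)

lemmas V = subring_inD[OF subring_loc]

lemma ideal_max: "ideal_in V M"
  unfolding ideal_in_def
proof (intro conjI ballI)
  show "M \<subseteq> V" using Q(1) by (auto simp: loc_max_def loc_at_def)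
  show "0 \<in> M" using maxI[of 0 1] Q(2) one_notin R by simp
next
  fix x y assume "x \<in> M" "y \<in> M"
  then obtain a c b d where x: "a \<in> Q" "c \<in> R" "c \<notin> Q" "c \<noteq> 0" "x = a / c"
    and y: "b \<in> Q" "d \<in> R" "d \<notin> Q" "d \<noteq> 0" "y = b / d"
    by (metis maxE)
  have "x + y = (a * d + b * c) / (c * d)" using x y by (auto simp: field_simps)
  moreover have "a * d + b * c \<in> Q" using x y Q by auto
  ultimately show "x + y \<in> M" using maxI[of "a * d + b * c" "c * d"] compl_mult R(5) x y by simp
next
  fix r x assume "r \<in> V" "x \<in> M"
  then obtain a c b d where x: "a \<in> Q" "c \<in> R" "c \<notin> Q" "x = a / c"
    and y: "b \<in> R" "d \<in> R" "d \<notin> Q" "r = b / d"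
    by (metis maxE locE)
  have "r * x = (b * a) / (d * c)" using x y by auto
  moreover have "b * a \<in> Q" using x y Q by auto
  ultimately show "r * x \<in> M" using maxI[of "b * a" "d * c"] compl_mult R(5) x y by simp
qed

lemmas Mx = ideal_inD[OF ideal_max]

lemma one_notin_max: "1 \<notin> M"
  by (auto elim!: maxE)

lemma max_contract: "x \<in> R \<Longrightarrow> x \<in> M \<Longrightarrow> x \<in> Q"
proof (elim maxE)
  fix a c assume *: "x \<in> R" "a \<in> Q" "c \<in> R" "c \<notin> Q" "c \<noteq> 0" "x = a / c"
  then have "x * c \<in> Q" by simp
  then show "x \<in> Q" using * prime_ideal_inD(3)[OF prime] by blast
qed

lemma prime_sub_max: "x \<in> Q \<Longrightarrow> x \<in> M"
  using maxI[of x 1] one_notin R by simp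

lemma unit_or_max:
  assumes "x \<in> V"
  shows "x \<in> M \<or> x \<noteq> 0 \<and> inverse x \<in> V"
proof -
  obtain a c where x: "a \<in> R" "c \<in> R" "c \<notin> Q" "c \<noteq> 0" "x = a / c"
    using assms by (rule locE)
  show ?thesis
  proof (cases "a \<in> Q")
    case True then show ?thesis using x by (auto simp: loc_max_def)
  next
    case False
    then have "inverse x = c / a" "a \<noteq> 0" using x compl_nonzero by auto
    then show ?thesis using x False locI by auto
  qed
qed

lemma inverse_max_notin: "x \<in> M \<Longrightarrow> x \<noteq> 0 \<Longrightarrow> inverse x \<notin> V"
  using Mx(4)[of "inverse x" x] one_notin_max by auto

lemma common_denominator:
  assumes "finite S" "\<And>i. i \<in> S \<Longrightarrow> f i \<in> V"
  shows "\<exists>s\<in>R - Q. \<forall>i\<in>S. s * f i \<in> R"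
  using assms
proof (induction S)
  case empty
  then show ?case using one_notin R by auto
next
  case (insert i S)
  then obtain s where s: "s \<in> R" "s \<notin> Q" "\<forall>i\<in>S. s * f i \<in> R" by auto
  obtain a c where x: "a \<in> R" "c \<in> R" "c \<notin> Q" "c \<noteq> 0" "f i = a / c"
    using insert.prems[of i] by (auto elim: locE)
  have "(c * s) * f j \<in> R" if "j \<in> insert i S" for j
  proof (cases "j = i")
    case True
    have "c * f i = a" using x by simp
    then have "(c * s) * f j = s * a" using True by (metis mult.assoc mult.commute)
    moreover have "s * a \<in> R" using s x R(5) by blast
    ultimately show ?thesis by (simp only:)
  next
    case False
    then have "c * (s * f j) \<in> R" using that s x R(5) by auto
    then show ?thesis by (simp add: mult.assoc)
  qed
  then show ?case using s x compl_mult R by (intro bexI[of _ "c * s"]) auto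
qed

text \<open>Integral closedness passes to localizations: if s clears the denominators of an equation
  for z, then s z is integral over R. The set F is the field in which R is integrally closed,
  \<open>K\<close> for A and the whole type for the integral closure.\<close>

lemma integral_over_loc_imp:
  assumes closed: "\<And>z. z \<in> F \<Longrightarrow> integral_over R z \<Longrightarrow> z \<in> R"
    and F: "\<And>s z. s \<in> R \<Longrightarrow> z \<in> F \<Longrightarrow> s * z \<in> F"
    and z: "z \<in> F" "integral_over V z"
  shows "z \<in> V"
proof -
  obtain d c where c: "\<And>i. i < d \<Longrightarrow> c i \<in> V" and x: "z ^ d = (\<Sum>i<d. c i * z ^ i)"
    using z(2)[unfolded integral_over_iff[OF subring_loc]] by blast
  obtain s where s: "s \<in> R" "s \<notin> Q" "\<And>i. i < d \<Longrightarrow> s * c i \<in> R"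
    using common_denominator[of "{..<d}" c] c by auto
  have "(s * z) ^ d = (\<Sum>i<d. s ^ d * (c i * z ^ i))"
    by (simp add: power_mult_distrib x sum_distrib_left)
  \<comment> \<open>Of the d factors s, one clears the denominator of \<open>c i\<close>, i of them
    go into the power of s z, and d - 1 - i are left over.\<close>
  also have "\<dots> = (\<Sum>i<d. (s ^ (d - Suc i) * (s * c i)) * (s * z) ^ i)"
  proof (rule sum.cong[OF refl])
    fix i assume "i \<in> {..<d}"
    then have "d = (d - Suc i) + 1 + i" by simp
    then have "s ^ d = s ^ (d - Suc i) * s * s ^ i" by (metis power_add power_one_right)
    then show "s ^ d * (c i * z ^ i) = (s ^ (d - Suc i) * (s * c i)) * (s * z) ^ i"
      by (simp add: power_mult_distrib)
  qed
  finally have "(s * z) ^ d = (\<Sum>i<d. (s ^ (d - Suc i) * (s * c i)) * (s * z) ^ i)" .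
  moreover have "\<forall>i<d. s ^ (d - Suc i) * (s * c i) \<in> R" using s R by auto
  ultimately have "integral_over R (s * z)"
    unfolding integral_over_iff[OF subring]
    by (intro exI[of _ d] exI[of _ "\<lambda>i. s ^ (d - Suc i) * (s * c i)"]) auto
  then have "s * z \<in> R" using closed F s z by blast
  then have "(s * z) / s \<in> V" using s locI by blast
  then show ?thesis using s compl_nonzero by simp
qed

end

subsection \<open>Discrete valuation rings\<close>

text \<open>A discrete valuation ring described without a valuation: n is the valuation of z. It is
  unique because t is a nonunit of V.\<close>

definition uniformizer :: "'l::field set \<Rightarrow> 'l set \<Rightarrow> 'l \<Rightarrow> bool" where
  "uniformizer V F t \<longleftrightarrow> t \<in> V \<and> t \<noteq> 0 \<and> inverse t \<notin> V \<and>
     (\<forall>z\<in>F. z \<noteq> 0 \<longrightarrow> (\<exists>n::int. \<exists>u. u \<in> V \<and> inverse u \<in> V \<and> u \<noteq> 0 \<and> z = t powi n * u))"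

lemma uniformizerE:
  assumes "uniformizer V F t" "z \<in> F" "z \<noteq> 0"
  obtains n u where "u \<in> V" "inverse u \<in> V" "u \<noteq> 0" "z = t powi n * u"
  using assms unfolding uniformizer_def by blast

lemma unit_powi:
  assumes V: "subring_in V" and v: "v \<in> V" "inverse v \<in> V"
  shows "v powi n \<in> V"
  using subring_inD(7)[OF V] v by (auto simp: power_int_def)

lemma uniformizer_powi_mem_iff:
  assumes V: "subring_in V" and t: "t \<in> V" "t \<noteq> 0" "inverse t \<notin> V"
    and u: "u \<in> V" "inverse u \<in> V" "u \<noteq> 0"
  shows "t powi n * u \<in> V \<longleftrightarrow> 0 \<le> n"
proof
  assume *: "t powi n * u \<in> V"
  show "0 \<le> n"
  proof (rule ccontr)
    assume "\<not> 0 \<le> n"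
    \<comment> \<open>Chosen to make n + k = -1, so that multiplying by t^k and the inverse of u
      leaves the inverse of t.\<close>
    define k where "k = nat (- 1 - n)"
    have n: "n = - 1 - int k" using \<open>\<not> 0 \<le> n\<close> by (simp add: k_def)
    have "t powi n * u * (inverse u * t ^ k) \<in> V"
      by (rule subring_inD(5)[OF V * subring_inD(5)[OF V u(2) subring_inD(7)[OF V t(1)]]])
    also have "t powi n * u * (inverse u * t ^ k) = t powi n * t powi (int k)"
      using u by simp
    also have "\<dots> = t powi (n + int k)" using t by (simp only: power_int_add simp_thms)
    also have "\<dots> = t powi (- 1)" by (simp add: n)
    finally show False using t by simp
  qed
next
  assume "0 \<le> n"
  then show "t powi n * u \<in> V"
    using t u subring_inD[OF V] by (auto simp: power_int_def)
qed

lemma uniformizer_scaled_mem_iff: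
  assumes V: "subring_in V" and t: "t \<in> V" "t \<noteq> 0" "inverse t \<notin> V"
    and u: "u \<in> V" "inverse u \<in> V" "u \<noteq> 0"
  shows "(\<exists>v\<in>V. t powi n * u = t powi k * v) \<longleftrightarrow> k \<le> n"
proof -
  have "(\<exists>v\<in>V. t powi n * u = t powi k * v) \<longleftrightarrow> t powi (n - k) * u \<in> V"
  proof
    assume "\<exists>v\<in>V. t powi n * u = t powi k * v"
    then show "t powi (n - k) * u \<in> V" using t by (auto simp: power_int_diff field_simps)
  next
    assume "t powi (n - k) * u \<in> V"
    moreover have "t powi n * u = t powi k * (t powi (n - k) * u)"
      using t by (simp add: power_int_diff field_simps)
    ultimately show "\<exists>v\<in>V. t powi n * u = t powi k * v" by blast
  qed
  then show ?thesis using uniformizer_powi_mem_iff[OF assms, of "n - k"] by simp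
qed

context localization
begin

text \<open>The classical criterion: if \<open>y M \<subseteq> a V\<close> with \<open>y \<notin> a V\<close>, then \<open>u = y / a\<close> maps \<open>M\<close> into
  \<open>V\<close>; as \<open>u \<notin> V\<close>, it does not map \<open>M\<close> into itself, so \<open>u t = 1\<close> for some \<open>t \<in> M\<close>.\<close>
lemma ex_max_generator:
  assumes a: "a \<noteq> 0" and y: "\<not> (\<exists>v\<in>V. y = a * v)" "\<And>m. m \<in> M \<Longrightarrow> \<exists>v\<in>V. y * m = a * v"
    and closed: "(\<And>m. m \<in> M \<Longrightarrow> y / a * m \<in> M) \<Longrightarrow> y / a \<in> V"
  obtains t where "t \<in> Q" "t \<noteq> 0" "\<And>x. x \<in> M \<Longrightarrow> \<exists>v\<in>V. x = t * v"
proof -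
  define u where "u = y / a"
  have "u \<notin> V" using y(1) a by (auto simp: u_def)
  then obtain m where m: "m \<in> M" "u * m \<notin> M" using closed by (auto simp: u_def)
  have uV: "u * x \<in> V" if "x \<in> M" for x using y(2)[OF that] a by (auto simp: u_def)
  then have unit: "u * m \<noteq> 0" "inverse (u * m) \<in> V" using unit_or_max m by blast+
  \<comment> \<open>This element is 1 / u. Taking its numerator t puts the generator into Q itself;
    then u t is the unit c instead of 1.\<close>
  then have "m * inverse (u * m) \<in> M" using m Mx by blast
  then obtain t c where t: "t \<in> Q" "c \<in> R" "c \<notin> Q" "c \<noteq> 0" "m * inverse (u * m) = t / c"
    by (rule maxE)
  have ut: "u * t = c" using t unit by (simp add: field_simps)
  have "\<exists>v\<in>V. x = t * v" if x: "x \<in> M" for x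
  proof
    show "u * x * inverse c \<in> V" using uV[OF x] inverse_compl t V by blast
    show "x = t * (u * x * inverse c)" using ut t by (simp add: field_simps flip: ut)
  qed
  moreover have "t \<noteq> 0" using ut t by auto
  ultimately show ?thesis using that t by blast
qed

text \<open>Divide z by t as often as possible. If t^N = z w, more than N divisions would make t a
  unit, so the process stops, and the last quotient lies outside M = tV, hence is a unit. Elements
  of F are quotients of two such elements.\<close>

lemma uniformizer_of_generator:
  assumes t: "t \<in> Q" "t \<noteq> 0" "\<And>x. x \<in> M \<Longrightarrow> \<exists>v\<in>V. x = t * v"
    and dvd: "\<And>z. z \<in> V \<Longrightarrow> z \<noteq> 0 \<Longrightarrow> \<exists>N. \<exists>v\<in>V. t ^ N = z * v"
    and F: "\<And>z. z \<in> F \<Longrightarrow> \<exists>a\<in>V. \<exists>c\<in>V. c \<noteq> 0 \<and> z = a / c"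
  shows "uniformizer V F t"
proof -
  have tM: "t \<in> M" and tV: "t \<in> V" using t prime_sub_max Mx(1) by auto
  have it: "inverse t \<notin> V" using inverse_max_notin tM t by blast
  have dec: "\<exists>n u. u \<in> V \<and> inverse u \<in> V \<and> u \<noteq> 0 \<and> z = t ^ n * u" if z: "z \<in> V" "z \<noteq> 0" for z
  proof -
    define D where "D = (\<lambda>n. \<exists>v\<in>V. z = t ^ n * v)"
    obtain N w where N: "w \<in> V" "t ^ N = z * w" using dvd z by blast
    have bnd: "n \<le> N" if "D n" for n
    proof (rule ccontr)
      assume "\<not> n \<le> N"
      then obtain k where k: "n = N + Suc k" using less_iff_Suc_add by (metis add_Suc_right not_le)
      obtain v where v: "v \<in> V" "z = t ^ n * v" using \<open>D n\<close> by (auto simp: D_def)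
      have "t ^ N * (t * (t ^ k * v * w)) = t ^ N * 1" using N(2) v k by (simp add: power_add algebra_simps)
      then have "t * (t ^ k * v * w) = 1" using t by simp
      then have "inverse t = t ^ k * v * w" by (metis inverse_unique)
      then show False using it tV v N V by auto
    qed
    have "D 0" using z by (auto simp: D_def)
    then have "D (GREATEST n. D n)" using bnd by (rule GreatestI_nat)
    then obtain n where n: "D n" "\<not> D (Suc n)"
      using Greatest_le_nat[of D "Suc (GREATEST n. D n)" N] bnd by auto
    then obtain v where v: "v \<in> V" "z = t ^ n * v" by (auto simp: D_def)
    have "v \<notin> M"
    proof
      assume "v \<in> M"
      then obtain v' where "v' \<in> V" "v = t * v'" using t by blast
      then have "D (Suc n)" using v by (auto simp: D_def)
      then show False using n by blast
    qed
    then show ?thesis using unit_or_max[OF v(1)] v by blast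
  qed
  have "\<exists>n::int. \<exists>u. u \<in> V \<and> inverse u \<in> V \<and> u \<noteq> 0 \<and> z = t powi n * u"
    if z: "z \<in> F" "z \<noteq> 0" for z
  proof -
    obtain a c where ac: "a \<in> V" "c \<in> V" "c \<noteq> 0" "z = a / c" using F z by blast
    have "a \<noteq> 0" using ac z by auto
    obtain n u where u: "u \<in> V" "inverse u \<in> V" "u \<noteq> 0" "a = t ^ n * u"
      using dec[OF ac(1) \<open>a \<noteq> 0\<close>] by blast
    obtain m w where w: "w \<in> V" "inverse w \<in> V" "w \<noteq> 0" "c = t ^ m * w"
      using dec[OF ac(2,3)] by blast
    have "z = t powi (int n - int m) * (u * inverse w)"
      using ac u w t by (simp add: power_int_diff field_simps)
    moreover have "u * inverse w \<in> V" "inverse (u * inverse w) \<in> V" "u * inverse w \<noteq> 0"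
      using u w V by auto
    ultimately show ?thesis by blast
  qed
  then show ?thesis using tV t it by (auto simp: uniformizer_def)
qed

end

subsection \<open>Powers of a maximal ideal\<close>

lemma ideal_gen_least: "ideal_in R J \<Longrightarrow> G \<subseteq> J \<Longrightarrow> ideal_gen R G \<subseteq> J"
  by (auto simp: ideal_gen_def)

lemma ideal_gen_superset: "G \<subseteq> ideal_gen R G"
  by (auto simp: ideal_gen_def)

lemma ideal_in_self: "subring_in R \<Longrightarrow> ideal_in R R"
  by (auto simp: ideal_in_def subring_in_def)

text \<open>The inclusion of G in R matters: otherwise no ideal of R contains G and the empty
  intersection is the whole type.\<close>

lemma ideal_gen_ideal:
  assumes "subring_in R" "G \<subseteq> R"
  shows "ideal_in R (ideal_gen R G)"
proof -
  have "ideal_gen R G \<subseteq> R" using assms ideal_gen_least ideal_in_self by blast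
  then show ?thesis by (auto simp: ideal_in_def ideal_gen_def)
qed

lemma ideal_pow_ideal:
  assumes "subring_in R" "ideal_in R J"
  shows "ideal_in R (ideal_pow R J n)"
proof (induction n)
  case 0
  then show ?case using assms ideal_in_self by simp
next
  case (Suc n)
  have "{x * y |x y. x \<in> J \<and> y \<in> ideal_pow R J n} \<subseteq> R"
    using ideal_inD(1)[OF Suc] ideal_inD(1)[OF assms(2)] subring_inD[OF assms(1)] by blast
  then show ?case unfolding ideal_pow.simps ideal_mult_def by (rule ideal_gen_ideal[OF assms(1)])
qed

lemma ideal_pow_SucI: "x \<in> J \<Longrightarrow> y \<in> ideal_pow R J n \<Longrightarrow> x * y \<in> ideal_pow R J (Suc n)"
  using ideal_gen_superset[of "{x * y |x y. x \<in> J \<and> y \<in> ideal_pow R J n}" R]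
  by (auto simp: ideal_mult_def)

lemma power_mem_ideal_pow:
  assumes "subring_in R" "x \<in> J"
  shows "x ^ n \<in> ideal_pow R J n"
proof (induction n)
  case 0
  then show ?case using subring_inD[OF assms(1)] by simp
next
  case (Suc n)
  then show ?case using ideal_pow_SucI[OF assms(2) Suc] by simp
qed

context localization
begin

text \<open>The powers of Q are the contractions of the ideals t^n V. One inclusion holds because
  these contractions are ideals that absorb the products generating the next power. The other rests
  on \<open>max\<close>, which says that R / Q is a field.\<close>

lemma ideal_pow_iff:
  assumes max: "\<And>s. s \<in> R \<Longrightarrow> s \<notin> Q \<Longrightarrow> \<exists>r\<in>R. 1 - s * r \<in> Q"
    and t: "t \<in> Q" "\<And>x. x \<in> M \<Longrightarrow> \<exists>v\<in>V. x = t * v"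
  shows "x \<in> ideal_pow R Q n \<longleftrightarrow> x \<in> R \<and> (\<exists>v\<in>V. x = t ^ n * v)"
proof
  define J where "J = (\<lambda>n. {x \<in> R. \<exists>v\<in>V. x = t ^ n * v})"
  have J: "ideal_in R (J n)" for n
    unfolding ideal_in_def
  proof (intro conjI ballI)
    show "J n \<subseteq> R" "0 \<in> J n" using R V(1) by (auto simp: J_def)
    show "x + y \<in> J n" if xy: "x \<in> J n" "y \<in> J n" for x y
    proof -
      obtain v w where "v \<in> V" "x = t ^ n * v" "w \<in> V" "y = t ^ n * w" "x \<in> R" "y \<in> R"
        using xy unfolding J_def by blast
      then have "v + w \<in> V" "x + y = t ^ n * (v + w)" "x + y \<in> R" using V R by (auto simp: algebra_simps)
      then show ?thesis unfolding J_def by blast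
    qed
    show "r * x \<in> J n" if rx: "r \<in> R" "x \<in> J n" for r x
    proof -
      obtain v where "v \<in> V" "x = t ^ n * v" "x \<in> R" using rx unfolding J_def by blast
      then have "r * v \<in> V" "r * x = t ^ n * (r * v)" "r * x \<in> R"
        using V(5) R(5) base_sub rx(1) by (auto simp: algebra_simps)
      then show ?thesis unfolding J_def by blast
    qed
  qed
  have sub: "ideal_pow R Q n \<subseteq> J n" for n
  proof (induction n)
    case 0
    then show ?case using base_sub by (auto simp: J_def)
  next
    case (Suc n)
    have "x * y \<in> J (Suc n)" if xy: "x \<in> Q" "y \<in> ideal_pow R Q n" for x y
    proof -
      obtain v where v: "v \<in> V" "x = t * v" using t(2) prime_sub_max xy by blast
      obtain w where w: "w \<in> V" "y = t ^ n * w" "y \<in> R" using Suc xy unfolding J_def by blast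
      have "x * y = t ^ Suc n * (v * w)" "v * w \<in> V" "x * y \<in> R"
        using v w V(5) R(5) xy Q(1) by auto
      then show ?thesis unfolding J_def by blast
    qed
    then show ?case
      unfolding ideal_pow.simps ideal_mult_def by (intro ideal_gen_least J) auto
  qed
  show "x \<in> R \<and> (\<exists>v\<in>V. x = t ^ n * v)" if "x \<in> ideal_pow R Q n"
    using that sub[of n] by (auto simp: J_def)
  show "x \<in> ideal_pow R Q n" if x: "x \<in> R \<and> (\<exists>v\<in>V. x = t ^ n * v)"
  proof -
    have P: "ideal_in R (ideal_pow R Q n)"
      using ideal_pow_ideal subring prime_ideal_inD(1)[OF prime] by blast
    obtain v where v: "v \<in> V" "x = t ^ n * v" using x by blast
    obtain a s where a: "a \<in> R" "s \<in> R" "s \<notin> Q" "s \<noteq> 0" "v = a / s" using v(1) by (rule locE)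
    have "s * x = a * t ^ n" using v a by simp
    then have sx: "s * x \<in> ideal_pow R Q n"
      using power_mem_ideal_pow[OF subring t(1)] ideal_inD(4)[OF P] a by simp
    obtain r where r: "r \<in> R" "1 - s * r \<in> Q" using max a by blast
    \<comment> \<open>Powers of \<open>Q\<close> are \<open>Q\<close>-primary: \<open>s\<close> is invertible modulo \<open>Q ^ n\<close> as \<open>(1 - s r) ^ n \<in> Q ^ n\<close>.\<close>
    have pow: "(1 - s * r) ^ n \<in> ideal_pow R Q n" by (rule power_mem_ideal_pow[OF subring r(2)])
    have sr: "1 - s * r \<in> R" using r a R by auto
    have "\<exists>q\<in>R. 1 - (1 - s * r) ^ n = s * q"
    proof (intro bexI)
      show "1 - (1 - s * r) ^ n = s * (r * (\<Sum>i<n. (1 - s * r) ^ i))"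
        using one_diff_power_eq[of "1 - s * r" n] by (simp add: mult.assoc)
      show "r * (\<Sum>i<n. (1 - s * r) ^ i) \<in> R"
        by (intro R(5) r subring_in_sum[OF subring] R(7) sr)
    qed
    then obtain q where q: "q \<in> R" "1 - (1 - s * r) ^ n = s * q" by blast
    have "(1 - s * r) ^ n + s * q = 1" by (simp flip: q(2))
    then have "x = x * ((1 - s * r) ^ n + s * q)" by simp
    then have "x = x * (1 - s * r) ^ n + q * (s * x)" by (simp only: distrib_left mult_ac)
    moreover have "x * (1 - s * r) ^ n \<in> ideal_pow R Q n" "q * (s * x) \<in> ideal_pow R Q n"
      using ideal_inD(4)[OF P] x pow sx q by auto
    ultimately show ?thesis using ideal_inD(3)[OF P] by metis
  qed
qed

end

subsection \<open>Existence of primes\<close>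

lemma ideal_adjoin:
  assumes R: "subring_in R" and J: "ideal_in R J" and x: "x \<in> R"
  shows "ideal_in R {q + r * x | q r. q \<in> J \<and> r \<in> R}" (is "ideal_in R ?I")
    and "J \<subseteq> {q + r * x | q r. q \<in> J \<and> r \<in> R}" and "x \<in> {q + r * x | q r. q \<in> J \<and> r \<in> R}"
proof -
  have I: "q + r * x \<in> ?I" if "q \<in> J" "r \<in> R" for q r using that by blast
  show "ideal_in R ?I"
    unfolding ideal_in_def
  proof (intro conjI ballI)
    show "?I \<subseteq> R" using ideal_inD(1)[OF J] subring_inD(3,5)[OF R] x by auto
    show "0 \<in> ?I" using I[of 0 0] ideal_inD(2)[OF J] subring_inD(1)[OF R] by simp
  next
    fix y z assume "y \<in> ?I" "z \<in> ?I"
    then obtain q r q' r' where yz: "y = q + r * x" "z = q' + r' * x" "q \<in> J" "r \<in> R" "q' \<in> J" "r' \<in> R"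
      by blast
    have "y + z = (q + q') + (r + r') * x" unfolding yz(1,2) by (simp add: algebra_simps)
    then show "y + z \<in> ?I"
      using I[of "q + q'" "r + r'"] ideal_inD(3)[OF J] subring_inD(3)[OF R] yz(3-6) by metis
  next
    fix s y assume "s \<in> R" "y \<in> ?I"
    then obtain q r where "y = q + r * x" "q \<in> J" "r \<in> R" "s \<in> R" by blast
    moreover have "s * (q + r * x) = s * q + (s * r) * x" by (simp add: algebra_simps)
    ultimately show "s * y \<in> ?I"
      using I[of "s * q" "s * r"] ideal_inD(4)[OF J] subring_inD(5)[OF R] by simp
  qed
  show "J \<subseteq> ?I" using I[of _ 0] subring_inD(1)[OF R] by auto
  show "x \<in> ?I" using I[of 0 1] subring_inD(2)[OF R] ideal_inD(2)[OF J] by auto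
qed

text \<open>Zorn's lemma gives an ideal maximal among those that contain J and avoid T; such an
  ideal is prime.\<close>

lemma ex_prime_ideal_disjoint:
  assumes R: "subring_in R" and J: "ideal_in R J"
    and T: "1 \<in> T" "\<And>x y. x \<in> T \<Longrightarrow> y \<in> T \<Longrightarrow> x * y \<in> T" and disj: "J \<inter> T = {}"
  obtains P where "prime_ideal_in R P" "J \<subseteq> P" "P \<inter> T = {}"
proof -
  define F where "F = {I. ideal_in R I \<and> J \<subseteq> I \<and> I \<inter> T = {}}"
  have "F \<noteq> {}" using J disj by (auto simp: F_def)
  moreover have "\<Union>C \<in> F" if C: "C \<noteq> {}" "subset.chain F C" for C
  proof -
    have CF: "C \<subseteq> F" and tot: "\<And>I I'. I \<in> C \<Longrightarrow> I' \<in> C \<Longrightarrow> I \<subseteq> I' \<or> I' \<subseteq> I"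
      using C(2) by (auto simp: subset_chain_def)
    have "x + y \<in> \<Union>C" if "x \<in> \<Union>C" "y \<in> \<Union>C" for x y
    proof -
      obtain I I' where "I \<in> C" "x \<in> I" "I' \<in> C" "y \<in> I'" using \<open>x \<in> \<Union>C\<close> \<open>y \<in> \<Union>C\<close> by blast
      then obtain I'' where I: "I'' \<in> C" "x \<in> I''" "y \<in> I''" using tot by blast
      then have "ideal_in R I''" using CF by (auto simp: F_def)
      then show ?thesis using I ideal_inD(3) by blast
    qed
    moreover have "0 \<in> \<Union>C" using C(1) CF by (auto simp: F_def ideal_in_def)
    moreover have "\<Union>C \<subseteq> R" "\<And>r x. r \<in> R \<Longrightarrow> x \<in> \<Union>C \<Longrightarrow> r * x \<in> \<Union>C"
      using CF unfolding F_def ideal_in_def by blast+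
    ultimately have "ideal_in R (\<Union>C)" unfolding ideal_in_def by blast
    moreover have "J \<subseteq> \<Union>C" using C(1) CF by (auto simp: F_def)
    moreover have "\<Union>C \<inter> T = {}" using CF by (auto simp: F_def)
    ultimately show ?thesis by (simp add: F_def)
  qed
  ultimately obtain P where P: "P \<in> F" "\<And>X. X \<in> F \<Longrightarrow> P \<subseteq> X \<Longrightarrow> X = P"
    using subset_Zorn_nonempty[of F] by metis
  have iP: "ideal_in R P" and JP: "J \<subseteq> P" and PT: "P \<inter> T = {}" using P(1) by (auto simp: F_def)
  \<comment> \<open>By maximality of P, the larger ideal P + Rx must meet T.\<close>
  have meet: "\<exists>q\<in>P. \<exists>r\<in>R. q + r * x \<in> T" if x: "x \<in> R" "x \<notin> P" for x
  proof -
    let ?I = "{q + r * x | q r. q \<in> P \<and> r \<in> R}"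
    have "?I \<notin> F" using P(2)[of ?I] ideal_adjoin(2,3)[OF R iP x(1)] x(2) by blast
    then have "?I \<inter> T \<noteq> {}"
      using ideal_adjoin(1,2)[OF R iP x(1)] JP unfolding F_def by blast
    then show ?thesis by blast
  qed
  have "x \<in> P \<or> y \<in> P" if xy: "x \<in> R" "y \<in> R" "x * y \<in> P" for x y
  proof (rule ccontr)
    assume "\<not> (x \<in> P \<or> y \<in> P)"
    then obtain q r q' r' where q: "q \<in> P" "r \<in> R" "q + r * x \<in> T" "q' \<in> P" "r' \<in> R" "q' + r' * y \<in> T"
      using meet xy by meson
    \<comment> \<open>A product of two elements of T, yet each term of its expansion contains q, q'
      or x y and so lies in P.\<close>
    have "(q + r * x) * (q' + r' * y) = q * (q' + r' * y) + ((r * x) * q' + (r * r') * (x * y))"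
      by (simp add: algebra_simps)
    also have "\<dots> \<in> P"
      using q xy ideal_inD(1)[OF iP]
      by (intro ideal_inD(3)[OF iP] ideal_inD(4)[OF iP _ xy(3)] ideal_inD(5)[OF iP _ q(1)]
          ideal_inD(4)[OF iP _ q(4)] subring_inD(3,5)[OF R]) auto
    finally show False using T(2)[OF q(3,6)] PT by blast
  qed
  moreover have "P \<noteq> R" using T(1) PT subring_inD(2)[OF R] by blast
  ultimately have "prime_ideal_in R P" using iP unfolding prime_ideal_in_def by blast
  then show ?thesis using that JP PT by blast
qed

subsection \<open>Relations with coefficients in a valuation ring\<close>

text \<open>Supplies the pivot of an elimination step: in a valuation ring an entry of least
  valuation divides all others.\<close>

lemma ex_dividing_all:
  assumes V: "subring_in V" and "finite J" "J \<noteq> {}" "\<And>i. i \<in> J \<Longrightarrow> f i \<in> K"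
    and total: "\<And>x y. x \<in> K \<Longrightarrow> y \<in> K \<Longrightarrow> (\<exists>r\<in>V. x = r * y) \<or> (\<exists>r\<in>V. y = r * x)"
  shows "\<exists>j\<in>J. \<forall>i\<in>J. \<exists>r\<in>V. f i = r * f j"
  using assms(2-4)
proof (induction J rule: finite_ne_induct)
  case (singleton x)
  have "f x = 1 * f x" by simp
  then show ?case using subring_inD(2)[OF V] by blast
next
  case (insert x J)
  then obtain j where j: "j \<in> J" "\<forall>i\<in>J. \<exists>r\<in>V. f i = r * f j" by auto
  have self: "\<exists>r\<in>V. f i = r * f i" for i using subring_inD(2)[OF V] by (intro bexI[of _ 1]) auto
  from total[of "f x" "f j"] insert j consider "\<exists>r\<in>V. f x = r * f j" | "\<exists>r\<in>V. f j = r * f x" by auto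
  then show ?case
  proof cases
    case 1
    then show ?thesis using j by blast
  next
    case 2
    then obtain r where r: "r \<in> V" "f j = r * f x" by blast
    have "\<exists>r\<in>V. f i = r * f x" if "i \<in> J" for i
    proof -
      obtain s where s: "s \<in> V" "f i = s * f j" using j \<open>i \<in> J\<close> by blast
      then have "f i = (s * r) * f x" using r by simp
      then show ?thesis using s r subring_inD(5)[OF V] by blast
    qed
    then show ?thesis using self by blast
  qed
qed

text \<open>Gaussian elimination on n + 1 rows and n columns. The pivot divides its column, so
  subtracting multiples of its row needs only multipliers from V. When no column remains, one row is
  left and gets coefficient 1; going back, only the coefficients of pivot rows are set anew.\<close>

lemma valuation_ring_relation:
  assumes V: "subring_in V" and K: "subring_in K" "V \<subseteq> K"
    and total: "\<And>x y. x \<in> K \<Longrightarrow> y \<in> K \<Longrightarrow> (\<exists>r\<in>V. x = r * y) \<or> (\<exists>r\<in>V. y = r * x)"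
    and "finite J" "card J = Suc n" "\<And>i k. i \<in> J \<Longrightarrow> k < n \<Longrightarrow> c i k \<in> K"
  shows "\<exists>l. (\<forall>i\<in>J. l i \<in> V) \<and> (\<exists>j\<in>J. l j = 1) \<and> (\<forall>k<n. (\<Sum>i\<in>J. l i * c i k) = 0)"
  using assms(5-7)
proof (induction n arbitrary: J c)
  case 0
  then show ?case using subring_inD(2)[OF V] by (intro exI[of _ "\<lambda>_. 1"]) (auto simp: card_Suc_eq)
next
  case (Suc n)
  have "J \<noteq> {}" using Suc.prems by auto
  have "\<exists>j\<in>J. \<forall>i\<in>J. \<exists>r\<in>V. c i n = r * c j n"
  proof (rule ex_dividing_all[where f = "\<lambda>i. c i n" and K = K, OF V Suc.prems(1) \<open>J \<noteq> {}\<close>])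
    show "c i n \<in> K" if "i \<in> J" for i using Suc.prems(3)[OF that] by simp
  qed (fact total)
  then obtain j where j: "j \<in> J" "\<forall>i\<in>J. \<exists>r\<in>V. c i n = r * c j n" by blast
  then obtain r where r: "\<And>i. i \<in> J \<Longrightarrow> r i \<in> V" "\<And>i. i \<in> J \<Longrightarrow> c i n = r i * c j n" by metis
  define J' where "J' = J - {j}"
  have J': "finite J'" "card J' = Suc n" "J = insert j J'" "j \<notin> J'"
    using Suc.prems j by (auto simp: J'_def)
  have "c i k - r i * c j k \<in> K" if "i \<in> J'" "k < n" for i k
    using that J' j r(1) K Suc.prems(3) by (intro subring_inD(4,5)[OF K(1)]) auto
  then obtain l where l: "\<And>i. i \<in> J' \<Longrightarrow> l i \<in> V" "\<exists>i\<in>J'. l i = 1"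
    "\<And>k. k < n \<Longrightarrow> (\<Sum>i\<in>J'. l i * (c i k - r i * c j k)) = 0"
    using Suc.IH[OF J'(1,2), of "\<lambda>i k. c i k - r i * c j k"] by auto
  \<comment> \<open>Row j receives what collects in front of it when the relation between the rows
    c_i - r_i c_j is expanded.\<close>
  define l' where "l' = l(j := - (\<Sum>i\<in>J'. l i * r i))"
  have l'J: "(\<Sum>i\<in>J'. l' i * f i) = (\<Sum>i\<in>J'. l i * f i)" for f
    using J'(4) by (intro sum.cong) (auto simp: l'_def)
  have sum: "(\<Sum>i\<in>J. l' i * c i k) = (\<Sum>i\<in>J'. l i * (c i k - r i * c j k))" for k
  proof -
    have "(\<Sum>i\<in>J. l' i * c i k) = l' j * c j k + (\<Sum>i\<in>J'. l i * c i k)"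
      using J' l'J by simp
    also have "\<dots> = (\<Sum>i\<in>J'. l i * (c i k - r i * c j k))"
      by (simp add: l'_def sum_distrib_right right_diff_distrib sum_subtractf mult.assoc)
    finally show ?thesis .
  qed
  have "(\<Sum>i\<in>J. l' i * c i k) = 0" if "k < Suc n" for k
  proof (cases "k = n")
    case True
    have "c i n - r i * c j n = 0" if "i \<in> J'" for i using r(2)[of i] J'(3) that by simp
    then show ?thesis unfolding sum using True by simp
  next
    case False
    then show ?thesis unfolding sum using l(3) that by simp
  qed
  moreover have "l' i \<in> V" if "i \<in> J" for i
  proof (cases "i = j")
    case True
    have "(\<Sum>i\<in>J'. l i * r i) \<in> V"
      using l(1) r(1) J'(3) by (intro subring_in_sum[OF V] subring_inD(5)[OF V]) auto
    then show ?thesis using True subring_inD(6)[OF V] by (simp add: l'_def)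
  next
    case False
    then show ?thesis using that J' l(1) by (simp add: l'_def)
  qed
  moreover have "\<exists>i\<in>J. l' i = 1" using l(2) J' by (auto simp: l'_def)
  ultimately show ?case by blast
qed

subsection \<open>The Dedekind domain at a prime\<close>

text \<open>The last two assumptions encode that \<pi> has valuation 1 at p.\<close>

locale dedekind_prime = A: localization A p for A p :: "'l::field set" +
  fixes \<pi> :: 'l
  assumes dedekind: "dedekind_domain A" and p_nonzero: "p \<noteq> {0}"
    and pi_in: "\<pi> \<in> p" and pi_val1: "\<pi> \<notin> ideal_pow A p 2"
begin

abbreviation "K \<equiv> frac_field A"

lemma K_I: "a \<in> A \<Longrightarrow> c \<in> A \<Longrightarrow> c \<noteq> 0 \<Longrightarrow> a / c \<in> K"
  by (auto simp: frac_field_def)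

lemma K_E:
  assumes "x \<in> K"
  obtains a c where "a \<in> A" "c \<in> A" "c \<noteq> 0" "x = a / c"
  using assms by (auto simp: frac_field_def)

lemma A_sub_K: "x \<in> A \<Longrightarrow> x \<in> K"
  using K_I[of x 1] A.R by simp

lemma subring_K: "subring_in K"
  unfolding subring_in_def
proof (intro conjI ballI)
  fix x y assume "x \<in> K" "y \<in> K"
  then obtain a c b d where x: "a \<in> A" "c \<in> A" "c \<noteq> 0" "x = a / c"
    and y: "b \<in> A" "d \<in> A" "d \<noteq> 0" "y = b / d"
    by (metis K_E)
  have "x + y = (a * d + b * c) / (c * d)" "x - y = (a * d - b * c) / (c * d)"
    "x * y = (a * b) / (c * d)"
    using x y by (auto simp: field_simps)
  then show "x + y \<in> K" "x - y \<in> K" "x * y \<in> K"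
    using x y A.R by (auto intro!: K_I)
qed (use A_sub_K A.R in auto)

lemma K_inverse:
  assumes "x \<in> K"
  shows "inverse x \<in> K"
proof -
  obtain a c where ac: "a \<in> A" "c \<in> A" "c \<noteq> 0" "x = a / c" using assms by (rule K_E)
  then have inv: "inverse x = c / a" by simp
  show ?thesis
  proof (cases "a = 0")
    case True
    then show ?thesis using ac A_sub_K A.R by simp
  next
    case False
    then show ?thesis unfolding inv using ac K_I by blast
  qed
qed

lemma V_sub_K: "A.V \<subseteq> K"
  using A.compl_nonzero unfolding loc_at_def frac_field_def by blast

lemma integrally_closed: "z \<in> K \<Longrightarrow> integral_over A z \<Longrightarrow> z \<in> A"
  using dedekind by (auto simp: dedekind_domain_def)

lemma p_maximal: "maximal_ideal_in A p"
  using dedekind A.prime p_nonzero by (auto simp: dedekind_domain_def)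

lemma ex_inverse_mod_p:
  assumes s: "s \<in> A" "s \<notin> p"
  shows "\<exists>r\<in>A. 1 - s * r \<in> p"
proof -
  let ?I = "{q + r * s | q r. q \<in> p \<and> r \<in> A}"
  note I = ideal_adjoin[OF A.subring prime_ideal_inD(1)[OF A.prime] s(1)]
  have "?I = p \<or> ?I = A" using p_maximal I(1,2) unfolding maximal_ideal_in_def by blast
  then have "?I = A" using I(3) s by blast
  then obtain q r where "q \<in> p" "r \<in> A" "1 = q + r * s" using A.R(2) by blast
  then have "1 - s * r = q" by (simp add: algebra_simps)
  then show ?thesis using \<open>q \<in> p\<close> \<open>r \<in> A\<close> by blast
qed

text \<open>The only nonzero prime of A_p is the maximal ideal, so x lies in the radical of a A_p.
  Otherwise aA would avoid all s x^k with s outside p, and so would a prime containing it. That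
  prime is nonzero, hence maximal, and lies inside p, so it equals p; but x is in p.\<close>

lemma power_dvd_up_to_unit:
  assumes x: "x \<in> p" and a: "a \<in> A" "a \<noteq> 0"
  shows "\<exists>k. \<exists>v\<in>A.V. x ^ k = a * v"
proof (rule ccontr)
  assume neg: "\<not> ?thesis"
  define T where "T = {s * x ^ k | s k. s \<in> A \<and> s \<notin> p}"
  define J where "J = (*) a ` A"
  have J: "ideal_in A J"
    unfolding ideal_in_def
  proof (intro conjI ballI)
    show "J \<subseteq> A" using a A.R by (auto simp: J_def)
    show "0 \<in> J" using A.R(1) by (auto simp: J_def intro!: image_eqI[of _ _ 0])
    show "y + z \<in> J" if "y \<in> J" "z \<in> J" for y z
      using that A.R(3) by (auto simp: J_def simp flip: distrib_left)
    show "r * y \<in> J" if ry: "r \<in> A" "y \<in> J" for r y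
    proof -
      obtain z where "y = a * z" "z \<in> A" using ry by (auto simp: J_def)
      then have "r * y = a * (r * z)" "r * z \<in> A" using ry A.R(5) by auto
      then show ?thesis by (auto simp: J_def)
    qed
  qed
  have T1: "1 * x ^ k \<in> T" for k using A.R(2) A.one_notin unfolding T_def by blast
  have T2: "y * z \<in> T" if yz: "y \<in> T" "z \<in> T" for y z
  proof -
    obtain s k s' k' where "y = s * x ^ k" "s \<in> A" "s \<notin> p" "z = s' * x ^ k'" "s' \<in> A" "s' \<notin> p"
      using yz by (auto simp: T_def)
    then have "y * z = (s * s') * x ^ (k + k')" "s * s' \<in> A" "s * s' \<notin> p"
      using A.R(5) A.compl_mult by (auto simp: power_add)
    then show ?thesis unfolding T_def by blast
  qed
  have "J \<inter> T = {}"
  proof (rule ccontr)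
    assume "J \<inter> T \<noteq> {}"
    then obtain r s k where r: "r \<in> A" "s \<in> A" "s \<notin> p" "a * r = s * x ^ k" by (auto simp: J_def T_def)
    then have "s \<noteq> 0" using A.compl_nonzero by blast
    then have "x ^ k = a * (r / s)" using r by (simp add: field_simps)
    then show False using neg r A.locI by blast
  qed
  then obtain P where P: "prime_ideal_in A P" "J \<subseteq> P" "P \<inter> T = {}"
    using ex_prime_ideal_disjoint[OF A.subring J _ T2] T1[of 0] by auto
  have "a \<in> J" using A.R(2) by (auto simp: J_def intro!: image_eqI[of _ _ 1])
  then have "P \<noteq> {0}" using P a by auto
  then have "maximal_ideal_in A P" using P dedekind by (auto simp: dedekind_domain_def)
  moreover have "P \<subseteq> p"
  proof
    fix s assume s: "s \<in> P"
    then have "s \<in> A" using P ideal_inD(1) prime_ideal_inD(1) by blast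
    moreover have "s * x ^ 0 \<notin> T" using s P by auto
    ultimately show "s \<in> p" unfolding T_def by blast
  qed
  ultimately have "p = P \<or> p = A"
    using prime_ideal_inD(1)[OF A.prime] unfolding maximal_ideal_in_def by blast
  then have "p = P" using prime_ideal_inD(2)[OF A.prime] by blast
  moreover have "x \<notin> P" using T1[of 1] P by auto
  ultimately show False using x by blast
qed

lemma p_finitely_generated:
  obtains G where "finite G" "G \<subseteq> p" "\<And>x. x \<in> p \<Longrightarrow> x \<in> rspan A G"
proof -
  obtain G where G: "finite G" "G \<subseteq> p" "p = ideal_gen A G"
    using dedekind prime_ideal_inD(1)[OF A.prime]
    unfolding dedekind_domain_def noetherian_ring_def by blast
  have GA: "G \<subseteq> A" using G A.Q(1) by blast
  have "ideal_in A (rspan A G)"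
    unfolding ideal_in_def
  proof (intro conjI ballI)
    show "rspan A G \<subseteq> A"
      unfolding rspan_def using GA by (auto intro!: subring_in_sum[OF A.subring] A.R(5))
  qed (auto intro: rspan_zero rspan_add rspan_scale A.subring)
  moreover have "G \<subseteq> rspan A G" using rspan_generator[OF A.subring G(1)] by blast
  ultimately have "p \<subseteq> rspan A G" unfolding G(3) by (rule ideal_gen_least)
  then show ?thesis using that G by blast
qed

lemma max_sub_rspan:
  assumes G: "\<And>x. x \<in> p \<Longrightarrow> x \<in> rspan A G" and x: "x \<in> A.M"
  shows "x \<in> rspan A.V G"
proof -
  obtain a c where x: "a \<in> p" "c \<in> A" "c \<notin> p" "c \<noteq> 0" "x = a / c" using x by (rule A.maxE)
  have "a \<in> rspan A.V G" using G[OF x(1)] rspan_mono[of A A.V] A.base_sub by blast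
  then have "inverse c * a \<in> rspan A.V G"
    using A.inverse_compl x by (intro rspan_scale A.subring_loc) auto
  then show ?thesis by (simp add: x field_simps)
qed

text \<open>Add the generators one by one. Some power of g is a multiple of a, so there is a last
  exponent m with y g^m outside aV; the factor g^m does not disturb the generators treated
  before.\<close>

lemma ex_colon_element:
  assumes a: "a \<in> p" "a \<noteq> 0" and G: "finite G" "G \<subseteq> p"
  shows "\<exists>y\<in>A.V. \<not> (\<exists>v\<in>A.V. y = a * v) \<and> (\<forall>g\<in>G. \<exists>v\<in>A.V. y * g = a * v)"
  using G
proof (induction G)
  case empty
  have "\<not> (\<exists>v\<in>A.V. 1 = a * v)"
  proof
    assume "\<exists>v\<in>A.V. 1 = a * v"
    then have "1 \<in> A.M" using A.Mx(5)[OF _ A.prime_sub_max[OF a(1)]] by metis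
    then show False using A.one_notin_max by blast
  qed
  then show ?case using A.V(2) by blast
next
  case (insert g G)
  then obtain y where y: "y \<in> A.V" "\<not> (\<exists>v\<in>A.V. y = a * v)" "\<forall>g\<in>G. \<exists>v\<in>A.V. y * g = a * v" by auto
  define D where "D k \<longleftrightarrow> (\<exists>v\<in>A.V. y * g ^ k = a * v)" for k
  obtain k v where k: "v \<in> A.V" "g ^ k = a * v"
    using power_dvd_up_to_unit[of g a] insert a A.Q(1) by auto
  have "y * g ^ k = a * (y * v)" using k by simp
  then have "D k" using y k A.V(5) unfolding D_def by blast
  moreover have "\<not> D 0" using y(2) by (simp add: D_def)
  ultimately obtain m where m: "\<not> D m" "D (Suc m)"
    using ex_least_nat_less[of D k] by (metis lessI less_Suc_eq_le order_refl)
  have gV: "g \<in> A.V" using insert A.Q(1) A.base_sub by auto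
  have "\<exists>v\<in>A.V. (y * g ^ m) * h = a * v" if h: "h \<in> insert g G" for h
  proof (cases "h = g")
    case True
    have "(y * g ^ m) * h = y * g ^ Suc m" using True by (simp add: mult_ac)
    then show ?thesis using m(2) unfolding D_def by (simp only:)
  next
    case False
    then obtain w where w: "w \<in> A.V" "y * h = a * w" using y h by blast
    then have "(y * g ^ m) * h = a * (w * g ^ m)" by (metis mult.assoc mult.commute)
    then show ?thesis using w A.V(5,7) gV by blast
  qed
  moreover have "y * g ^ m \<in> A.V" using y A.V(5,7) gV by blast
  moreover have "\<not> (\<exists>v\<in>A.V. y * g ^ m = a * v)" using m(1) by (simp add: D_def)
  ultimately show ?case by blast
qed

text \<open>The classical argument for a noetherian, integrally closed local domain of dimension
  one: y / a cannot map M into itself, since M is spanned by G and y / a would then be integral over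
  A_p, hence in A_p.\<close>

lemma ex_uniformizer:
  obtains t where "t \<in> p" "\<And>x. x \<in> A.M \<Longrightarrow> \<exists>v\<in>A.V. x = t * v" "uniformizer A.V K t"
proof -
  obtain G where G: "finite G" "G \<subseteq> p" "\<And>x. x \<in> p \<Longrightarrow> x \<in> rspan A G"
    using p_finitely_generated by blast
  obtain a where a: "a \<in> p" "a \<noteq> 0" using p_nonzero A.Q(2) by blast
  obtain y where y: "y \<in> A.V" "\<not> (\<exists>v\<in>A.V. y = a * v)" "\<forall>g\<in>G. \<exists>v\<in>A.V. y * g = a * v"
    using ex_colon_element[OF a G(1,2)] by blast
  have yM: "\<exists>v\<in>A.V. y * m = a * v" if m: "m \<in> A.M" for m
  proof -
    obtain r where r: "m = (\<Sum>g\<in>G. r g * g)" "\<forall>g\<in>G. r g \<in> A.V"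
      using max_sub_rspan[OF G(3) m] unfolding rspan_def by blast
    obtain v where v: "\<And>g. g \<in> G \<Longrightarrow> v g \<in> A.V" "\<And>g. g \<in> G \<Longrightarrow> y * g = a * v g" using y(3) by metis
    have "y * m = (\<Sum>g\<in>G. r g * (y * g))" by (simp add: r sum_distrib_left mult_ac)
    also have "\<dots> = (\<Sum>g\<in>G. r g * (a * v g))" using v by simp
    also have "\<dots> = a * (\<Sum>g\<in>G. r g * v g)" by (simp add: sum_distrib_left mult_ac)
    finally have "y * m = a * (\<Sum>g\<in>G. r g * v g)" .
    moreover have "(\<Sum>g\<in>G. r g * v g) \<in> A.V"
      using v r by (intro subring_in_sum[OF A.subring_loc] A.V(5)) auto
    ultimately show ?thesis by blast
  qed
  \<comment> \<open>\<open>integral_over_of_stable\<close> needs a nonzero generator; if all were 0,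
    so would be a.\<close>
  obtain g0 where g0: "g0 \<in> G" "g0 \<noteq> 0"
  proof (rule ccontr)
    assume "\<not> thesis"
    then have "\<forall>g\<in>G. g = 0" using that by blast
    then have "(\<Sum>g\<in>G. r g * g) = 0" for r by (intro sum.neutral) simp
    then have "a = 0" using G(3)[OF a(1)] unfolding rspan_def by blast
    then show False using a by simp
  qed
  have closed: "y / a \<in> A.V" if st: "\<And>m. m \<in> A.M \<Longrightarrow> y / a * m \<in> A.M"
  proof -
    have "y / a * g \<in> rspan A.V G" if "g \<in> G" for g
      using max_sub_rspan[OF G(3)] st A.prime_sub_max G(2) that by blast
    then have int: "integral_over A.V (y / a)"
      using integral_over_of_stable[OF A.subring_loc G(1) g0] by blast
    have "y * inverse a \<in> K"
      using y V_sub_K a A.Q(1) A_sub_K K_inverse subring_inD(5)[OF subring_K] by blast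
    then have "y / a \<in> K" by (simp add: divide_inverse)
    then show ?thesis
      using A.integral_over_loc_imp[of K "y / a"] integrally_closed int
        A_sub_K subring_inD(5)[OF subring_K] by blast
  qed
  obtain t where t: "t \<in> p" "t \<noteq> 0" "\<And>x. x \<in> A.M \<Longrightarrow> \<exists>v\<in>A.V. x = t * v"
    using A.ex_max_generator[OF a(2) y(2) yM closed] by metis
  have "uniformizer A.V K t"
  proof (rule A.uniformizer_of_generator[OF t])
    fix z assume z: "z \<in> A.V" "z \<noteq> 0"
    then obtain b c where bc: "b \<in> A" "c \<in> A" "c \<notin> p" "c \<noteq> 0" "z = b / c" by (metis A.locE)
    then obtain k v where k: "v \<in> A.V" "t ^ k = b * v" using power_dvd_up_to_unit[OF t(1), of b] z by auto
    then have "t ^ k = z * (c * v)" using bc by simp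
    then show "\<exists>N. \<exists>v\<in>A.V. t ^ N = z * v" using k bc A.base_sub A.V(5) by blast
  next
    fix z assume "z \<in> K"
    then show "\<exists>a\<in>A.V. \<exists>c\<in>A.V. c \<noteq> 0 \<and> z = a / c" by (metis K_E A.base_sub)
  qed
  then show ?thesis using that t by blast
qed

text \<open>Write \<pi> = t v. If v were in M, then \<pi> would lie in t^2 V and in A, that is, in
  the square of p. So v is a unit and \<pi> is as good a uniformizer as t.\<close>

lemma max_eq: "x \<in> A.M \<Longrightarrow> \<exists>v\<in>A.V. x = \<pi> * v" and uniformizer_pi: "uniformizer A.V K \<pi>"
proof -
  obtain t where t: "t \<in> p" "\<And>x. x \<in> A.M \<Longrightarrow> \<exists>v\<in>A.V. x = t * v" "uniformizer A.V K t"
    using ex_uniformizer by blast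
  obtain v where v: "v \<in> A.V" "\<pi> = t * v" using t(2) A.prime_sub_max pi_in by blast
  have "v \<notin> A.M"
  proof
    assume "v \<in> A.M"
    then obtain w where "w \<in> A.V" "v = t * w" using t(2) by blast
    then have "w \<in> A.V" "\<pi> = t ^ 2 * w" using v by (auto simp: power2_eq_square)
    then have "\<pi> \<in> ideal_pow A p 2"
      using A.ideal_pow_iff[OF ex_inverse_mod_p t(1,2), of \<pi> 2] pi_in A.Q(1) by blast
    then show False using pi_val1 by blast
  qed
  then have u: "v \<noteq> 0" "inverse v \<in> A.V" using A.unit_or_max v by blast+
  have t0: "t \<noteq> 0" "t \<in> A.V" "inverse t \<notin> A.V" using t(3) by (auto simp: uniformizer_def)
  show "\<exists>v\<in>A.V. x = \<pi> * v" if x: "x \<in> A.M"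
  proof -
    obtain w where "w \<in> A.V" "x = t * w" using t(2)[OF x] by blast
    then have "x = \<pi> * (inverse v * w)" "inverse v * w \<in> A.V" using v u A.V(5) by auto
    then show ?thesis by blast
  qed
  have "inverse \<pi> \<notin> A.V" "\<pi> \<noteq> 0"
    using A.inverse_max_notin[of \<pi>] A.prime_sub_max pi_in v u t0 by auto
  moreover have "\<exists>n::int. \<exists>u. u \<in> A.V \<and> inverse u \<in> A.V \<and> u \<noteq> 0 \<and> z = \<pi> powi n * u"
    if z: "z \<in> K" "z \<noteq> 0" for z
  proof -
    obtain n w where w: "w \<in> A.V" "inverse w \<in> A.V" "w \<noteq> 0" "z = t powi n * w"
      using uniformizerE[OF t(3) z] by blast
    have "z = \<pi> powi n * (inverse v powi n * w)"
      using w u v by (simp add: power_int_mult_distrib power_int_inverse)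
    moreover have "inverse v powi n * w \<in> A.V"
      using w u v unit_powi[OF A.subring_loc] A.V(5) by auto
    moreover have "inverse (inverse v powi n * w) \<in> A.V"
      using w u v unit_powi[OF A.subring_loc] A.V(5) by (simp add: power_int_inverse)
    ultimately show ?thesis using w u by (intro exI[of _ n] exI[of _ "inverse v powi n * w"]) auto
  qed
  ultimately show "uniformizer A.V K \<pi>"
    using A.base_sub pi_in A.Q(1) unfolding uniformizer_def by blast
qed

lemma pi_facts: "\<pi> \<in> A.V" "\<pi> \<noteq> 0" "inverse \<pi> \<notin> A.V" "\<pi> \<in> A.M" "\<pi> \<in> A"
  using uniformizer_pi A.prime_sub_max pi_in A.Q(1) by (auto simp: uniformizer_def)

lemma powi_mem_V_iff:
  "u \<in> A.V \<Longrightarrow> inverse u \<in> A.V \<Longrightarrow> u \<noteq> 0 \<Longrightarrow> \<pi> powi n * u \<in> A.V \<longleftrightarrow> 0 \<le> n"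
  using uniformizer_powi_mem_iff[OF A.subring_loc] pi_facts by blast

lemma V_total:
  assumes "x \<in> K" "y \<in> K"
  shows "(\<exists>r\<in>A.V. x = r * y) \<or> (\<exists>r\<in>A.V. y = r * x)"
proof (cases "x = 0 \<or> y = 0")
  case True
  then show ?thesis using A.V(1) by (metis mult_zero_left)
next
  case False
  have "x * inverse y \<in> K" using assms K_inverse subring_inD(5)[OF subring_K] by blast
  then obtain n u where u: "u \<in> A.V" "inverse u \<in> A.V" "u \<noteq> 0" "x * inverse y = \<pi> powi n * u"
    using uniformizerE[OF uniformizer_pi] False by (metis nonzero_imp_inverse_nonzero mult_eq_0_iff)
  show ?thesis
  proof (cases "0 \<le> n")
    case True
    then have "x * inverse y \<in> A.V" using powi_mem_V_iff u by simp
    moreover have "x = (x * inverse y) * y" using False by simp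
    ultimately show ?thesis by blast
  next
    case neg: False
    have "\<pi> powi (- n) * inverse u \<in> A.V" using powi_mem_V_iff[of "inverse u" "- n"] u neg by simp
    moreover have "y = (\<pi> powi (- n) * inverse u) * x"
    proof -
      have "y = inverse (x * inverse y) * x" using False by (simp add: field_simps)
      then show ?thesis unfolding u(4) by (simp add: power_int_minus)
    qed
    ultimately show ?thesis by blast
  qed
qed

end

subsection \<open>The integral closure\<close>

text \<open>The variable z in \<open>spanning\<close> is universally quantified: the g k span the
  whole type over \<open>K\<close>, so n bounds the degree of the extension.\<close>

locale finite_extension = dedekind_prime A p \<pi> for A p :: "'l::field set" and \<pi> +
  fixes n :: nat and g :: "nat \<Rightarrow> 'l"
  assumes spanning: "\<exists>c. (\<forall>k<n. c k \<in> frac_field A) \<and> z = (\<Sum>k<n. c k * g k)"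
begin

abbreviation "B \<equiv> int_closure A"

lemma subring_B: "subring_in B"
  by (rule subring_int_closure[OF A.subring])

lemma A_sub_B: "x \<in> A \<Longrightarrow> x \<in> B"
  using integral_over_self[OF A.subring] by (simp add: int_closure_def)

lemma B_Int_K: "x \<in> B \<Longrightarrow> x \<in> K \<Longrightarrow> x \<in> A"
  using integrally_closed by (simp add: int_closure_def)

text \<open>The coefficient 1 keeps the relation nontrivial modulo the maximal ideal of A_p. Later
  arguments pick its first or last unit coefficient.\<close>

lemma relation: "\<exists>l. (\<forall>i\<le>n. l i \<in> A.V) \<and> (\<exists>j\<le>n. l j = 1) \<and> (\<Sum>i\<le>n. l i * x i) = 0"
proof -
  obtain c where c: "\<And>z k. k < n \<Longrightarrow> c z k \<in> K" "\<And>z. z = (\<Sum>k<n. c z k * g k)"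
    using spanning by metis
  have "\<exists>l. (\<forall>i\<in>{..n}. l i \<in> A.V) \<and> (\<exists>j\<in>{..n}. l j = 1) \<and>
      (\<forall>k<n. (\<Sum>i\<in>{..n}. l i * c (x i) k) = 0)"
    by (rule valuation_ring_relation[where c = "\<lambda>i. c (x i)",
          OF A.subring_loc subring_K V_sub_K V_total]) (auto intro: c(1))
  then obtain l where l: "\<forall>i\<le>n. l i \<in> A.V" "\<exists>j\<le>n. l j = 1"
    "\<And>k. k < n \<Longrightarrow> (\<Sum>i\<le>n. l i * c (x i) k) = 0"
    by auto
  have "(\<Sum>i\<le>n. l i * x i) = (\<Sum>i\<le>n. \<Sum>k<n. l i * c (x i) k * g k)"
    by (rule sum.cong[OF refl], subst c(2)) (simp add: sum_distrib_left mult.assoc)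
  also have "\<dots> = (\<Sum>k<n. \<Sum>i\<le>n. l i * c (x i) k * g k)" by (rule sum.swap)
  also have "\<dots> = 0" using l(3) by (simp flip: sum_distrib_right)
  finally show ?thesis using l by blast
qed

text \<open>Multiplied by b_d^(d-1), the equation becomes monic in b_d z.\<close>

lemma integral_over_leading_multiple:
  assumes b: "\<And>i. i \<le> d \<Longrightarrow> b i \<in> A" and eq: "(\<Sum>i\<le>d. b i * z ^ i) = 0" and d: "0 < d"
  shows "integral_over A (b d * z)"
proof -
  have top: "b d * z ^ d = - (\<Sum>i<d. b i * z ^ i)"
    using eq by (simp add: lessThan_Suc_atMost[symmetric] eq_neg_iff_add_eq_0 add.commute)
  have "(b d * z) ^ d = b d ^ (d - 1) * (- (\<Sum>i<d. b i * z ^ i))"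
  proof -
    have "b d ^ d = b d ^ (d - 1) * b d" using d by (simp flip: power_Suc2)
    then show ?thesis using top by (simp only: power_mult_distrib mult.assoc)
  qed
  also have "\<dots> = (\<Sum>i<d. - (b d ^ (d - 1) * (b i * z ^ i)))"
    by (simp add: sum_distrib_left sum_negf)
  also have "\<dots> = (\<Sum>i<d. (- (b i * b d ^ (d - 1 - i))) * (b d * z) ^ i)"
  proof (rule sum.cong[OF refl])
    fix i assume "i \<in> {..<d}"
    then have "d - 1 = (d - 1 - i) + i" by simp
    then have "b d ^ (d - 1) = b d ^ (d - 1 - i) * b d ^ i" by (metis power_add)
    then have "b d ^ (d - 1) * (b i * z ^ i) = (b i * b d ^ (d - 1 - i)) * (b d * z) ^ i"
      by (simp only: power_mult_distrib mult_ac)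
    then show "- (b d ^ (d - 1) * (b i * z ^ i)) = (- (b i * b d ^ (d - 1 - i))) * (b d * z) ^ i"
      by simp
  qed
  finally show ?thesis
    unfolding integral_over_iff[OF A.subring] using b A.R
    by (intro exI[of _ d] exI[of _ "\<lambda>i. - (b i * b d ^ (d - 1 - i))"]) simp
qed

text \<open>Take a relation between the powers of z and clear denominators; its last nonzero
  coefficient b_d makes b_d z integral. That the denominator comes from A is used later to measure
  it by a power of \<pi>.\<close>

lemma ex_fraction: "\<exists>a\<in>B. \<exists>c\<in>A. c \<noteq> 0 \<and> z = a / c"
proof -
  obtain l j where l: "\<forall>i\<le>n. l i \<in> A.V" "j \<le> n" "l j = 1" "(\<Sum>i\<le>n. l i * z ^ i) = 0"
    using relation[of "\<lambda>i. z ^ i"] by blast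
  obtain s where s: "s \<in> A" "s \<notin> p" "\<forall>i\<in>{..n}. s * l i \<in> A"
    using A.common_denominator[of "{..n}" l] l by auto
  define b where "b i = s * l i" for i
  have b: "b i \<in> A" if "i \<le> n" for i using s that by (simp add: b_def)
  have bj: "b j \<noteq> 0" using l s A.compl_nonzero by (simp add: b_def)
  define d where "d = (GREATEST i. i \<le> n \<and> b i \<noteq> 0)"
  have d: "d \<le> n" "b d \<noteq> 0"
    using GreatestI_nat[of "\<lambda>i. i \<le> n \<and> b i \<noteq> 0" j n] bj l unfolding d_def by auto
  have above: "b i = 0" if "d < i" "i \<le> n" for i
  proof (rule ccontr)
    assume "b i \<noteq> 0"
    then have "i \<le> d" using Greatest_le_nat[of "\<lambda>i. i \<le> n \<and> b i \<noteq> 0" i n] that unfolding d_def by auto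
    then show False using that by simp
  qed
  have "(\<Sum>i\<le>n. b i * z ^ i) = s * (\<Sum>i\<le>n. l i * z ^ i)"
    by (simp add: b_def sum_distrib_left mult_ac)
  then have "(\<Sum>i\<le>n. b i * z ^ i) = 0" using l by simp
  moreover have "(\<Sum>i\<le>n. b i * z ^ i) = (\<Sum>i\<le>d. b i * z ^ i)"
    using d above by (intro sum.mono_neutral_right) auto
  ultimately have eq: "(\<Sum>i\<le>d. b i * z ^ i) = 0" by simp
  have "0 < d" using eq d(2) by (cases d) auto
  then have "b d * z \<in> B"
    using integral_over_leading_multiple[OF _ eq] b d by (auto simp: int_closure_def)
  moreover have "z = (b d * z) / b d" using d by simp
  ultimately show ?thesis using b d by blast
qed

text \<open>Lying over. J is the contraction to B of the ideal generated by \<pi> in the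
  localization of B at A - p. It avoids A - p: if s x = \<pi> y with s, x in A - p, then y is in B
  and in K, hence in A, and s x would be in p.\<close>

lemma ex_prime_over: "\<exists>P. prime_ideal_in B P \<and> P \<inter> A = p"
proof -
  define J where "J = {x \<in> B. \<exists>s\<in>A - p. \<exists>y\<in>B. s * x = \<pi> * y}"
  note B = subring_inD[OF subring_B]
  have J: "ideal_in B J"
    unfolding ideal_in_def
  proof (intro conjI ballI)
    show "J \<subseteq> B" by (auto simp: J_def)
    have "1 * 0 = \<pi> * 0" by simp
    then show "0 \<in> J" using A.R(2) A.one_notin B(1) unfolding J_def by blast
  next
    fix x y assume "x \<in> J" "y \<in> J"
    then obtain s u t v where *: "x \<in> B" "s \<in> A" "s \<notin> p" "u \<in> B" "s * x = \<pi> * u"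
      "y \<in> B" "t \<in> A" "t \<notin> p" "v \<in> B" "t * y = \<pi> * v" by (auto simp: J_def)
    have "(s * t) * (x + y) = t * (s * x) + s * (t * y)" by (simp add: algebra_simps)
    also have "\<dots> = \<pi> * (t * u + s * v)" unfolding * by (simp add: algebra_simps)
    finally have "(s * t) * (x + y) = \<pi> * (t * u + s * v)" .
    moreover have "s * t \<in> A - p" "t * u + s * v \<in> B" "x + y \<in> B"
      using * A.compl_mult A.R(5) B(3,5) A_sub_B by auto
    ultimately show "x + y \<in> J" unfolding J_def by blast
  next
    fix r x assume "r \<in> B" "x \<in> J"
    then obtain s u where *: "x \<in> B" "s \<in> A" "s \<notin> p" "u \<in> B" "s * x = \<pi> * u" "r \<in> B"
      by (auto simp: J_def)
    have "s * (r * x) = r * (s * x)" by (simp add: mult_ac)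
    also have "\<dots> = \<pi> * (r * u)" unfolding * by (simp add: mult_ac)
    finally have "s * (r * x) = \<pi> * (r * u)" .
    then show "r * x \<in> J" using * B(5) unfolding J_def by blast
  qed
  have "J \<inter> (A - p) = {}"
  proof (rule ccontr)
    assume "J \<inter> (A - p) \<noteq> {}"
    then obtain x s y where *: "x \<in> A" "x \<notin> p" "s \<in> A" "s \<notin> p" "y \<in> B" "s * x = \<pi> * y"
      by (auto simp: J_def)
    then have "y = (s * x) / \<pi>" using pi_facts by simp
    then have "y \<in> K" using * A.R(5) K_I pi_facts by blast
    then have "s * x \<in> p" using * B_Int_K A.Q(5) pi_in by simp
    then show False using * A.compl_mult by blast
  qed
  then obtain P where P: "prime_ideal_in B P" "J \<subseteq> P" "P \<inter> (A - p) = {}"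
    using ex_prime_ideal_disjoint[OF subring_B J, of "A - p"] A.R(2,5) A.one_notin A.compl_mult
    by auto
  have "p \<subseteq> P"
  proof
    fix x assume x: "x \<in> p"
    then obtain v where "v \<in> A.V" "x = \<pi> * v" using max_eq A.prime_sub_max by blast
    then obtain a s where "a \<in> A" "s \<in> A" "s \<notin> p" "s \<noteq> 0" "x = \<pi> * (a / s)" by (metis A.locE)
    then have "s * x = \<pi> * a" "a \<in> B" "s \<in> A - p" using A_sub_B by auto
    then have "x \<in> J" using x A.Q(1) A_sub_B unfolding J_def by blast
    then show "x \<in> P" using P by blast
  qed
  then have "P \<inter> A = p" using P A.Q(1) by blast
  then show ?thesis using P by blast
qed

end

subsection \<open>The local ring at a prime of the integral closure\<close>

locale prime_over = finite_extension A p \<pi> n g + P: localization "int_closure A" P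
  for A p :: "'l::field set" and \<pi> n g P +
  assumes contract: "P \<inter> A = p"
begin

lemma V_sub: "x \<in> A.V \<Longrightarrow> x \<in> P.V"
proof (elim A.locE)
  fix a c assume "a \<in> A" "c \<in> A" "c \<notin> p" "x = a / c"
  then show "x \<in> P.V" using P.locI A_sub_B contract by blast
qed

lemma max_sub: "x \<in> A.M \<Longrightarrow> x \<in> P.M"
proof (elim A.maxE)
  fix a c assume "a \<in> p" "c \<in> A" "c \<notin> p" "x = a / c"
  then show "x \<in> P.M" using P.maxI A_sub_B contract by blast
qed

lemma max_contract: "x \<in> A.V \<Longrightarrow> x \<in> P.M \<Longrightarrow> x \<in> A.M"
  using A.unit_or_max V_sub P.inverse_max_notin by blast

text \<open>B / P is a field because it is integral over A / p. Choose m such that some monic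
  expression of degree m + 1 in x lies in P but none of degree m does. Written as x y + c_0, it has
  y outside P, so c_0 is outside p and invertible modulo p.\<close>

lemma ex_inverse_mod_P:
  assumes x: "x \<in> B" "x \<notin> P"
  shows "\<exists>r\<in>B. 1 - x * r \<in> P"
proof -
  define D where "D d \<longleftrightarrow> (\<exists>c. (\<forall>i<d. c i \<in> A) \<and> x ^ d + (\<Sum>i<d. c i * x ^ i) \<in> P)" for d
  have "integral_over A x" using x by (simp add: int_closure_def)
  then obtain d c where c: "\<forall>i<d. c i \<in> A" "x ^ d = (\<Sum>i<d. c i * x ^ i)"
    unfolding integral_over_iff[OF A.subring] by blast
  have "x ^ d + (\<Sum>i<d. (- c i) * x ^ i) = 0" using c(2) by (simp add: sum_negf)
  then have "D d" using c(1) A.R(6) P.Q(2) unfolding D_def by (intro exI[of _ "\<lambda>i. - c i"]) auto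
  moreover have "\<not> D 0" using P.one_notin by (simp add: D_def)
  ultimately obtain m where m: "\<not> D m" "D (Suc m)"
    using ex_least_nat_less[of D d] by (metis lessI less_Suc_eq_le order_refl)
  obtain c where c: "\<forall>i<Suc m. c i \<in> A" and cP: "x ^ Suc m + (\<Sum>i<Suc m. c i * x ^ i) \<in> P"
    using m(2) unfolding D_def by blast
  define y where "y = x ^ m + (\<Sum>i<m. c (Suc i) * x ^ i)"
  have y: "y \<in> B"
    unfolding y_def using c A_sub_B x by (intro P.R(3,5,7) subring_in_sum[OF subring_B]) auto
  have "(\<Sum>i<Suc m. c i * x ^ i) = c 0 + x * (\<Sum>i<m. c (Suc i) * x ^ i)"
    by (subst sum.lessThan_Suc_shift) (simp add: sum_distrib_left mult_ac)
  then have "x ^ Suc m + (\<Sum>i<Suc m. c i * x ^ i) = x * y + c 0"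
    by (simp add: y_def distrib_left)
  then have xy: "x * y + c 0 \<in> P" using cP by simp
  have "\<forall>i<m. c (Suc i) \<in> A" using c by simp
  then have "y \<notin> P" using m(1) unfolding D_def y_def by metis
  then have xyP: "x * y \<notin> P" using x y P.compl_mult by blast
  have c0: "c 0 \<in> A" using c by simp
  have "c 0 \<notin> p"
  proof
    assume "c 0 \<in> p"
    then have "(x * y + c 0) - c 0 \<in> P"
      using xy contract ideal_in_diff[OF subring_B prime_ideal_inD(1)[OF P.prime]] by blast
    then show False using xyP by simp
  qed
  then obtain r where r: "r \<in> A" "1 - c 0 * r \<in> p" using ex_inverse_mod_p c0 by blast
  have "(1 - c 0 * r) + (x * y + c 0) * r \<in> P"
    using P.Q(3) P.Q(5)[OF A_sub_B[OF r(1)] xy] r(2) contract by blast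
  moreover have "(1 - c 0 * r) + (x * y + c 0) * r = 1 - x * (- (y * r))"
    by (simp add: algebra_simps)
  ultimately show ?thesis using P.R(5,6) y r A_sub_B by (intro bexI[of _ "- (y * r)"]) auto
qed

text \<open>In a relation between \<open>y\<^sub>0, \<dots>, y\<^sub>n\<close>, the first coefficient outside the maximal ideal, at \<open>j\<close> say,
  dominates the later terms, which are multiples of \<open>y\<^sub>j\<close> by elements of \<open>M\<close>; the earlier terms are
  divisible by \<open>\<pi>\<close>, and hence so is \<open>y\<^sub>j\<close>.\<close>
lemma descending_sequence_reaches_pi:
  assumes y: "\<And>i. y i \<in> P.V" and step: "\<And>i. \<exists>m\<in>P.M. y (Suc i) = y i * m"
  shows "\<exists>i. \<exists>v\<in>P.V. y i = \<pi> * v"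
proof -
  obtain l j0 where l: "\<forall>i\<le>n. l i \<in> A.V" "j0 \<le> n" "l j0 = 1" "(\<Sum>i\<le>n. l i * y i) = 0"
    using relation[of y] by blast
  define j where "j = (LEAST i. i \<le> n \<and> l i \<notin> A.M)"
  have ex: "j0 \<le> n \<and> l j0 \<notin> A.M" using l A.one_notin_max by simp
  have j: "j \<le> n" "l j \<notin> A.M" using LeastI[of "\<lambda>i. i \<le> n \<and> l i \<notin> A.M", OF ex] by (auto simp: j_def)
  have below: "l i \<in> A.M" if "i < j" for i
    using not_less_Least[of i "\<lambda>i. i \<le> n \<and> l i \<notin> A.M"] that j unfolding j_def by auto
  have mult: "\<exists>m\<in>P.M. y (j + Suc k) = y j * m" for k
  proof (induction k)
    case 0
    then show ?case using step[of j] by simp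
  next
    case (Suc k)
    obtain m m' where "m \<in> P.M" "y (j + Suc k) = y j * m" "m' \<in> P.M" "y (Suc (j + Suc k)) = y (j + Suc k) * m'"
      using Suc step[of "j + Suc k"] by blast
    then have "m * m' \<in> P.M" "y (j + Suc (Suc k)) = y j * (m * m')" using P.Mx(1,4) by auto
    then show ?case by blast
  qed
  have "\<exists>m\<in>P.M. y i = y j * m" if "j < i" for i
    using mult[of "i - Suc j"] that by simp
  then obtain m where m: "\<And>i. j < i \<Longrightarrow> m i \<in> P.M" "\<And>i. j < i \<Longrightarrow> y i = y j * m i" by metis
  obtain v where v: "\<And>i. i < j \<Longrightarrow> v i \<in> A.V" "\<And>i. i < j \<Longrightarrow> l i = \<pi> * v i"
  proof -
    have "\<forall>i. \<exists>v. i < j \<longrightarrow> v \<in> A.V \<and> l i = \<pi> * v" using max_eq below by blast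
    then obtain v where "\<forall>i. i < j \<longrightarrow> v i \<in> A.V \<and> l i = \<pi> * v i" by (rule choice[THEN exE])
    then show ?thesis using that by blast
  qed
  \<comment> \<open>Factor y_j out of its own term and all later ones. The cofactor q is a unit of
    A_p plus an element of M, hence a unit of V, and the relation becomes y_j q = - \<pi> s.\<close>
  define q where "q = l j + (\<Sum>i\<in>{j<..n}. l i * m i)"
  define s where "s = (\<Sum>i<j. v i * y i)"
  have tailM: "(\<Sum>i\<in>{j<..n}. l i * m i) \<in> P.M"
    using l m V_sub by (intro ideal_in_sum[OF P.ideal_max] P.Mx(4)) auto
  have lj: "l j \<in> A.V" using l j by simp
  have qV: "q \<in> P.V" unfolding q_def using tailM P.Mx(1) lj V_sub by (intro P.V(3)) auto
  have "q \<notin> P.M"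
  proof
    assume "q \<in> P.M"
    then have "q - (\<Sum>i\<in>{j<..n}. l i * m i) \<in> P.M"
      using tailM ideal_in_diff[OF P.subring_loc P.ideal_max] by blast
    then show False using max_contract[OF lj] j by (simp add: q_def)
  qed
  then have q: "q \<noteq> 0" "inverse q \<in> P.V" using P.unit_or_max qV by blast+
  have split: "{..n} = {..<j} \<union> ({j} \<union> {j<..n})" using j by auto
  have "(\<Sum>i\<le>n. l i * y i) = (\<Sum>i<j. l i * y i) + (l j * y j + (\<Sum>i\<in>{j<..n}. l i * y i))"
    unfolding split by (subst sum.union_disjoint; auto)+
  also have "(\<Sum>i<j. l i * y i) = \<pi> * s"
    unfolding s_def sum_distrib_left using v by (intro sum.cong) (auto simp: mult_ac)
  also have "(\<Sum>i\<in>{j<..n}. l i * y i) = y j * (\<Sum>i\<in>{j<..n}. l i * m i)"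
    unfolding sum_distrib_left using m by (intro sum.cong) (auto simp: mult_ac)
  also have "l j * y j + y j * (\<Sum>i\<in>{j<..n}. l i * m i) = y j * q"
    by (simp add: q_def algebra_simps)
  finally have "y j * q = - (\<pi> * s)" using l(4) by (simp add: eq_neg_iff_add_eq_0 add.commute)
  then have "y j = \<pi> * (- s * inverse q)" using q by (simp add: field_simps)
  moreover have "s \<in> P.V"
    unfolding s_def using v y V_sub by (intro subring_in_sum[OF P.subring_loc] P.V(5)) auto
  ultimately show ?thesis using P.V(5,6) q by blast
qed

text \<open>Since \<pi> is in M, so is every u^i \<pi>. In a relation between 1, u, ..., u^n let j
  be the last unit coefficient: the later coefficients are multiples of \<pi>, so those terms add up
  to some m in M. Dividing by l_j gives an integral equation for u over V, and V is integrally
  closed.\<close>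

lemma stabilizer_of_max:
  assumes stable: "\<And>m. m \<in> P.M \<Longrightarrow> u * m \<in> P.M"
  shows "u \<in> P.V"
proof -
  have piM: "u ^ i * \<pi> \<in> P.M" for i
    using stable max_sub pi_facts by (induction i) (auto simp: mult.assoc)
  obtain l j0 where l: "\<forall>i\<le>n. l i \<in> A.V" "j0 \<le> n" "l j0 = 1" "(\<Sum>i\<le>n. l i * u ^ i) = 0"
    using relation[of "\<lambda>i. u ^ i"] by blast
  define j where "j = (GREATEST i. i \<le> n \<and> l i \<notin> A.M)"
  have "j0 \<le> n \<and> l j0 \<notin> A.M" using l A.one_notin_max by simp
  then have j: "j \<le> n" "l j \<notin> A.M"
    using GreatestI_nat[of "\<lambda>i. i \<le> n \<and> l i \<notin> A.M" j0 n] unfolding j_def by auto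
  have above: "l i \<in> A.M" if "j < i" "i \<le> n" for i
  proof (rule ccontr)
    assume "l i \<notin> A.M"
    then have "i \<le> j"
      using Greatest_le_nat[of "\<lambda>i. i \<le> n \<and> l i \<notin> A.M" i n] that unfolding j_def by auto
    then show False using that by simp
  qed
  have lj: "l j \<in> A.V" "l j \<noteq> 0" "inverse (l j) \<in> A.V" using l j A.unit_or_max by blast+
  define m where "m = (\<Sum>i\<in>{j<..n}. l i * u ^ i)"
  have m: "m \<in> P.M"
    unfolding m_def
  proof (rule ideal_in_sum[OF P.ideal_max])
    fix i assume "i \<in> {j<..n}"
    then obtain v where "v \<in> A.V" "l i = \<pi> * v" using above max_eq by (metis greaterThanAtMost_iff)
    then show "l i * u ^ i \<in> P.M" using P.Mx(4)[OF V_sub piM[of i], of v] by (simp add: mult_ac)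
  qed
  have split: "{..n} = {..<j} \<union> ({j} \<union> {j<..n})" using j by auto
  have "(\<Sum>i\<le>n. l i * u ^ i) = (\<Sum>i<j. l i * u ^ i) + (l j * u ^ j + m)"
    unfolding split m_def by (subst sum.union_disjoint; auto)+
  then have lu: "l j * u ^ j = - (\<Sum>i<j. l i * u ^ i) - m"
    using l(4) by (simp add: algebra_simps eq_neg_iff_add_eq_0)
  \<comment> \<open>There must be a constant coefficient, at index 0 < j, to absorb m. With j = 0
    the unit l_0 would equal - m.\<close>
  have "0 < j"
  proof (rule ccontr)
    assume "\<not> 0 < j"
    then have "l j = (-1) * m" using lu by simp
    then have "l j \<in> P.M" using P.Mx(4)[OF P.V(6)[OF P.V(2)] m] by simp
    then show False using max_contract lj j by blast
  qed
  define c where "c i = - (inverse (l j) * l i) + (if i = 0 then - (inverse (l j) * m) else 0)" for i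
  have "u ^ j = inverse (l j) * (l j * u ^ j)" using lj by simp
  also have "\<dots> = (\<Sum>i<j. - (inverse (l j) * l i) * u ^ i) + - (inverse (l j) * m)"
    unfolding lu by (simp add: right_diff_distrib sum_distrib_left sum_negf mult_ac)
  also have "- (inverse (l j) * m) = (\<Sum>i<j. (if i = 0 then - (inverse (l j) * m) else 0) * u ^ i)"
    using \<open>0 < j\<close> by (simp add: sum.delta if_distrib[of "\<lambda>x. x * _"] cong: if_cong)
  finally have "u ^ j = (\<Sum>i<j. c i * u ^ i)" by (simp only: c_def sum.distrib distrib_right)
  moreover have "c i \<in> P.V" if "i < j" for i
  proof -
    have li: "inverse (l j) * l i \<in> P.V" using lj l j that V_sub A.V(5) by simp
    have "inverse (l j) * m \<in> P.V" using lj m V_sub P.V(5) P.Mx(1) by blast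
    then have "(if i = 0 then - (inverse (l j) * m) else 0) \<in> P.V" using P.V(1,6) by simp
    then show ?thesis unfolding c_def using li P.V(3,6) by blast
  qed
  ultimately have "integral_over P.V u"
    unfolding integral_over_iff[OF P.subring_loc] by blast
  then show ?thesis
    using P.integral_over_loc_imp[of UNIV u] integral_over_int_closure[OF A.subring]
    by (auto simp: int_closure_def)
qed

text \<open>If no y as required existed, every y outside \<pi>V could be multiplied by an element of
  M without entering \<pi>V, and dependent choice would contradict
  \<open>descending_sequence_reaches_pi\<close>. The same lemma for the powers of t makes some t^N a
  multiple of \<pi>.\<close>

lemma ex_P_uniformizer:
  obtains t where "t \<in> P" "\<And>x. x \<in> P.M \<Longrightarrow> \<exists>v\<in>P.V. x = t * v" "uniformizer P.V UNIV t"
proof -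
  have pi0: "\<pi> \<noteq> 0" using pi_facts by simp
  have "\<exists>y\<in>P.V. \<not> (\<exists>v\<in>P.V. y = \<pi> * v) \<and> (\<forall>m\<in>P.M. \<exists>v\<in>P.V. y * m = \<pi> * v)"
  proof (rule ccontr)
    assume neg: "\<not> ?thesis"
    let ?Z = "\<lambda>y. y \<in> P.V \<and> \<not> (\<exists>v\<in>P.V. y = \<pi> * v)"
    have "\<exists>y. \<forall>i. ?Z (y i) \<and> (\<exists>m\<in>P.M. y (Suc i) = y i * m)"
    proof (rule dependent_nat_choice)
      have "\<not> (\<exists>v\<in>P.V. 1 = \<pi> * v)"
      proof
        assume "\<exists>v\<in>P.V. 1 = \<pi> * v"
        then have "1 \<in> P.M" using P.Mx(5)[OF _ max_sub] pi_facts by metis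
        then show False using P.one_notin_max by blast
      qed
      then show "\<exists>y. ?Z y" using P.V(2) by blast
      fix y assume y: "?Z y"
      then obtain m where m: "m \<in> P.M" "\<not> (\<exists>v\<in>P.V. y * m = \<pi> * v)" using neg by blast
      then have "?Z (y * m)" using y P.Mx(1) P.V(5) by (simp add: subset_iff)
      then show "\<exists>y'. ?Z y' \<and> (\<exists>m\<in>P.M. y' = y * m)" using m(1) by (intro exI[of _ "y * m"]) blast
    qed
    then show False using descending_sequence_reaches_pi by metis
  qed
  then obtain y where y: "y \<in> P.V" "\<not> (\<exists>v\<in>P.V. y = \<pi> * v)" "\<And>m. m \<in> P.M \<Longrightarrow> \<exists>v\<in>P.V. y * m = \<pi> * v"
    by blast
  obtain t where t: "t \<in> P" "t \<noteq> 0" "\<And>x. x \<in> P.M \<Longrightarrow> \<exists>v\<in>P.V. x = t * v"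
    using P.ex_max_generator[OF pi0 y(2,3) stabilizer_of_max] by metis
  have tM: "t \<in> P.M" and tV: "t \<in> P.V" using t P.prime_sub_max P.Mx(1) by auto
  have "\<exists>i. \<exists>v\<in>P.V. t ^ i = \<pi> * v"
    by (rule descending_sequence_reaches_pi) (use tM tV P.V(7) in \<open>auto simp: mult.commute\<close>)
  then obtain N v where N: "v \<in> P.V" "t ^ N = \<pi> * v" by blast
  have "uniformizer P.V UNIV t"
  proof (rule P.uniformizer_of_generator[OF t])
    fix z assume z: "z \<in> P.V" "z \<noteq> 0"
    \<comment> \<open>Writing 1 / z as a / c shows that z divides c, which is a unit times a power
      of \<pi>; and \<pi> divides t^N.\<close>
    obtain a c where ac: "a \<in> B" "c \<in> A" "c \<noteq> 0" "inverse z = a / c" using ex_fraction by blast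
    obtain k u where u: "u \<in> A.V" "inverse u \<in> A.V" "u \<noteq> 0" "c = \<pi> powi k * u"
      using uniformizerE[OF uniformizer_pi A_sub_K[OF ac(2)] ac(3)] by blast
    then have "0 \<le> k" using powi_mem_V_iff A.base_sub ac by blast
    then have ck: "c = \<pi> ^ nat k * u" using u by (simp add: power_int_def)
    have "c = z * a" using ac z by (simp add: field_simps)
    then have "\<pi> ^ nat k = z * (a * inverse u)" using ck u by (simp add: field_simps)
    then have "t ^ (N * nat k) = z * (a * inverse u * v ^ nat k)"
      by (simp add: power_mult N power_mult_distrib mult.assoc)
    moreover have "a * inverse u * v ^ nat k \<in> P.V"
      using ac u V_sub N P.base_sub by (intro P.V(5,7)) auto
    ultimately show "\<exists>N. \<exists>v\<in>P.V. t ^ N = z * v" by blast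
  next
    fix z :: 'l
    show "\<exists>a\<in>P.V. \<exists>c\<in>P.V. c \<noteq> 0 \<and> z = a / c"
      using ex_fraction[of z] P.base_sub A_sub_B by blast
  qed
  then show ?thesis using that t by blast
qed

text \<open>With z = t^m u and \<pi> = t^e w for units u, w, the valuation of z is m and the
  ramification index is e, so both sides say k e \<le> m. For z = 0 both hold.\<close>

lemma w_P_ge_iff: "ereal (of_int k) \<le> w_P B p P z \<longleftrightarrow> \<pi> powi (- k) * z \<in> P.V"
proof (cases "z = 0")
  case True
  then show ?thesis using P.V(1) by (simp add: w_P_def)
next
  case z0: False
  obtain t where t: "t \<in> P" "\<And>x. x \<in> P.M \<Longrightarrow> \<exists>v\<in>P.V. x = t * v" and unif: "uniformizer P.V UNIV t"
    using ex_P_uniformizer by blast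
  have tV: "t \<in> P.V" "t \<noteq> 0" "inverse t \<notin> P.V" using unif by (auto simp: uniformizer_def)
  note mem_iff = uniformizer_powi_mem_iff[OF P.subring_loc tV]
  note scaled_iff = uniformizer_scaled_mem_iff[OF P.subring_loc tV]
  have pow: "x \<in> ideal_pow B P n \<longleftrightarrow> x \<in> B \<and> (\<exists>v\<in>P.V. x = t ^ n * v)" for x n
    by (rule P.ideal_pow_iff[OF ex_inverse_mod_P t])
  have ord: "int (ord_in B P a) = m" if a: "a \<in> B" "a = t powi m * u"
    and u: "u \<in> P.V" "inverse u \<in> P.V" "u \<noteq> 0" for a m u
  proof -
    have "a \<in> ideal_pow B P n \<longleftrightarrow> int n \<le> m" for n
      using pow[of a n] a scaled_iff[OF u, of m "int n"] by simp
    moreover have "0 \<le> m" using mem_iff[OF u, of m] a P.base_sub by blast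
    ultimately have "ord_in B P a = nat m"
      unfolding ord_in_def by (intro Greatest_equality) auto
    then show ?thesis using \<open>0 \<le> m\<close> by simp
  qed
  obtain m u where u: "u \<in> P.V" "inverse u \<in> P.V" "u \<noteq> 0" "z = t powi m * u"
    using uniformizerE[OF unif UNIV_I z0] by blast
  obtain e w where w: "w \<in> P.V" "inverse w \<in> P.V" "w \<noteq> 0" "\<pi> = t powi e * w"
    using uniformizerE[OF unif UNIV_I, of \<pi>] pi_facts by blast
  have val: "val_P B P z = m"
  proof -
    let ?Q = "\<lambda>(a, c). a \<in> B \<and> c \<in> B \<and> a \<noteq> 0 \<and> c \<noteq> 0 \<and> z = a / c"
    \<comment> \<open>Whichever fraction \<open>SOME\<close> picks, the orders of numerator and
      denominator differ by m.\<close>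
    obtain a c where ac: "(SOME x. ?Q x) = (a, c)" by (cases "SOME x. ?Q x") auto
    obtain a0 c0 where "a0 \<in> B" "c0 \<in> A" "c0 \<noteq> 0" "z = a0 / c0" using ex_fraction by blast
    then have "?Q (a0, c0)" using A_sub_B z0 by auto
    then have "?Q (SOME x. ?Q x)" by (rule someI[of ?Q])
    then have "?Q (a, c)" unfolding ac .
    then have acB: "a \<in> B" "c \<in> B" "a \<noteq> 0" "c \<noteq> 0" "z = a / c" by auto
    obtain i x where x: "x \<in> P.V" "inverse x \<in> P.V" "x \<noteq> 0" "a = t powi i * x"
      using uniformizerE[OF unif UNIV_I acB(3)] by blast
    obtain j y where y: "y \<in> P.V" "inverse y \<in> P.V" "y \<noteq> 0" "c = t powi j * y"
      using uniformizerE[OF unif UNIV_I acB(4)] by blast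
    have "a = z * c" using acB by simp
    also have "\<dots> = t powi (m + j) * (u * y)" using u y tV by (simp add: power_int_add)
    finally have a: "a = t powi (m + j) * (u * y)" .
    have "int (ord_in B P a) = m + j"
    proof (rule ord[OF acB(1) a])
      show "u * y \<in> P.V" "u * y \<noteq> 0" using u y P.V(5) by auto
      show "inverse (u * y) \<in> P.V" using u y P.V(5) by (simp only: inverse_mult_distrib)
    qed
    moreover have "int (ord_in B P c) = j" using ord acB y by blast
    ultimately show ?thesis unfolding val_P_def ac Let_def by simp
  qed
  have e_pos: "0 < e"
  proof (rule ccontr)
    assume "\<not> 0 < e"
    then have "t powi (- e) * inverse w \<in> P.V" using mem_iff[of "inverse w" "- e"] w by simp
    moreover have "inverse \<pi> = t powi (- e) * inverse w" by (simp add: w power_int_minus)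
    ultimately show False using P.inverse_max_notin max_sub pi_facts by metis
  qed
  \<comment> \<open>Every element of p is \<pi> times an element of A_p, so \<pi> alone decides
    whether p lies in a power of P.\<close>
  have "p \<subseteq> ideal_pow B P k \<longleftrightarrow> int k \<le> e" for k
  proof
    assume "p \<subseteq> ideal_pow B P k"
    then have "\<pi> \<in> ideal_pow B P k" using pi_in by blast
    then show "int k \<le> e" using pow[of \<pi> k] scaled_iff[OF w(1-3), of e "int k"] w(4) by auto
  next
    assume k: "int k \<le> e"
    show "p \<subseteq> ideal_pow B P k"
    proof
      fix x assume x: "x \<in> p"
      obtain v where v: "v \<in> A.V" "x = \<pi> * v" using max_eq A.prime_sub_max x by blast
      obtain v' where "v' \<in> P.V" "\<pi> = t ^ k * v'" using scaled_iff[OF w(1-3), of e "int k"] k w(4) by auto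
      then have "v' * v \<in> P.V" "x = t ^ k * (v' * v)" using v V_sub P.V(5) by auto
      then show "x \<in> ideal_pow B P k" using pow[of x k] x A.Q(1) A_sub_B by blast
    qed
  qed
  then have ram: "ram_index B p P = nat e"
    using e_pos unfolding ram_index_def by (intro Greatest_equality) auto
  have "\<pi> powi (- k) * z = t powi (m - k * e) * (w powi (- k) * u)"
  proof -
    have "\<pi> powi (- k) = t powi (e * (- k)) * w powi (- k)"
      unfolding w(4) by (simp only: power_int_mult_distrib power_int_mult)
    moreover have "t powi (m - k * e) = t powi (e * (- k)) * t powi m"
      using tV by (simp add: mult.commute flip: power_int_add)
    ultimately show ?thesis unfolding u(4) by (simp only: mult_ac)
  qed
  moreover have "w powi (- k) * u \<in> P.V" "inverse (w powi (- k) * u) \<in> P.V" "w powi (- k) * u \<noteq> 0"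
  proof -
    show "w powi (- k) * u \<in> P.V" "w powi (- k) * u \<noteq> 0"
      using u w P.V(5) unit_powi[OF P.subring_loc] by auto
    have "inverse (w powi (- k) * u) = inverse w powi (- k) * inverse u"
      by (simp add: power_int_inverse)
    then show "inverse (w powi (- k) * u) \<in> P.V"
      using u w P.V(5) unit_powi[OF P.subring_loc, of "inverse w" "- k"] by simp
  qed
  ultimately have "\<pi> powi (- k) * z \<in> P.V \<longleftrightarrow> k * e \<le> m" using mem_iff by simp
  moreover have "ereal (of_int k) \<le> w_P B p P z \<longleftrightarrow> k * e \<le> m"
  proof -
    have "real_of_int k \<le> real_of_int m / real_of_int e \<longleftrightarrow> real_of_int (k * e) \<le> real_of_int m"
      using e_pos by (simp add: field_simps)
    then show ?thesis using z0 e_pos by (simp add: w_P_def val ram flip: of_int_mult)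
  qed
  ultimately show ?thesis by simp
qed

end

subsection \<open>Semi-reduced families\<close>

text \<open>Comparing with integers makes the floors disappear, also at the infinite values.\<close>

lemma efloor_ge_iff: "ereal (of_int k) \<le> efloor x \<longleftrightarrow> ereal (of_int k) \<le> x"
  by (cases x) (auto simp: efloor_def le_floor_iff)

context finite_extension
begin

text \<open>Equivalent to \<open>k \<le> w_S A B p z\<close>, see \<open>w_S_ge_iff\<close>.\<close>
definition ge_S :: "int \<Rightarrow> 'l \<Rightarrow> bool" where
  "ge_S k z \<longleftrightarrow> (\<forall>P\<in>primes_over A B p. \<pi> powi (- k) * z \<in> loc_at B P)"

lemma prime_overI:
  assumes "P \<in> primes_over A B p"
  shows "prime_over A p \<pi> n g P"
proof
  show "subring_in B" by (rule subring_B)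
  show "prime_ideal_in B P" "P \<inter> A = p" using assms by (auto simp: primes_over_def)
qed

lemma w_S_ge_iff: "ereal (of_int k) \<le> w_S A B p z \<longleftrightarrow> ge_S k z"
  unfolding w_S_def le_INF_iff ge_S_def using prime_over.w_P_ge_iff[OF prime_overI] by simp

lemma loc_B_facts:
  assumes "P \<in> primes_over A B p"
  shows "subring_in (loc_at B P)" "A.V \<subseteq> loc_at B P"
proof -
  interpret prime_over A p \<pi> n g P by (rule prime_overI[OF assms])
  show "subring_in (loc_at B P)" "A.V \<subseteq> loc_at B P" using P.subring_loc V_sub by auto
qed

lemma ge_S_scale:
  assumes "u \<in> A.V" "ge_S k z"
  shows "ge_S k (u * z)"
  unfolding ge_S_def
proof
  fix P assume P: "P \<in> primes_over A B p"
  then have "u * (\<pi> powi (- k) * z) \<in> loc_at B P"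
    using assms loc_B_facts[OF P] subring_inD(5)[OF loc_B_facts(1)[OF P]] by (auto simp: ge_S_def)
  then show "\<pi> powi (- k) * (u * z) \<in> loc_at B P" by (simp add: mult_ac)
qed

lemma ge_S_unit_iff:
  assumes "u \<in> A.V" "inverse u \<in> A.V" "u \<noteq> 0"
  shows "ge_S k (u * z) \<longleftrightarrow> ge_S k z"
  using ge_S_scale[OF assms(1), of k z] ge_S_scale[OF assms(2), of k "u * z"] assms(3)
  by (auto simp flip: mult.assoc)

lemma ge_S_shift: "ge_S k (\<pi> powi m * z) \<longleftrightarrow> ge_S (k - m) z"
proof -
  have "\<pi> powi (- k) * (\<pi> powi m * z) = \<pi> powi (- (k - m)) * z"
    using pi_facts by (simp add: mult.assoc[symmetric] add.commute flip: power_int_add)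
  then show ?thesis by (simp only: ge_S_def)
qed

lemma ge_S_sum:
  assumes "\<And>i. i \<in> I \<Longrightarrow> ge_S k (f i)"
  shows "ge_S k (\<Sum>i\<in>I. f i)"
  unfolding ge_S_def sum_distrib_left
  using assms loc_B_facts(1) by (auto simp: ge_S_def intro!: subring_in_sum)

lemma ge_S_mono:
  assumes "ge_S k z" "m \<le> k"
  shows "ge_S m z"
proof -
  have "ereal (of_int m) \<le> ereal (of_int k)" using assms(2) by simp
  then show ?thesis using assms(1) unfolding w_S_ge_iff[symmetric] by (rule order_trans)
qed

text \<open>A denominator of z in A is \<pi>^k times a unit of A_p, which gives a lower bound that
  is the same for all P; the infimum therefore stays above - \<infinity>.\<close>

lemma ex_ge_S: "\<exists>k. ge_S k z"
proof -
  obtain a c where ac: "a \<in> B" "c \<in> A" "c \<noteq> 0" "z = a / c" using ex_fraction by blast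
  obtain k u where u: "u \<in> A.V" "inverse u \<in> A.V" "u \<noteq> 0" "c = \<pi> powi k * u"
    using uniformizerE[OF uniformizer_pi A_sub_K[OF ac(2)] ac(3)] by blast
  have "ge_S 0 a"
    unfolding ge_S_def
  proof
    fix P assume P: "P \<in> primes_over A B p"
    interpret prime_over A p \<pi> n g P by (rule prime_overI[OF P])
    show "\<pi> powi - 0 * a \<in> P.V" using P.base_sub ac by simp
  qed
  then have "ge_S (- k - - k) (inverse u * a)" using ge_S_scale[OF u(2)] by simp
  then have "ge_S (- k) (\<pi> powi (- k) * (inverse u * a))" by (simp only: ge_S_shift)
  moreover have "z = \<pi> powi (- k) * (inverse u * a)"
    unfolding ac(4) u(4) by (simp add: power_int_minus divide_inverse mult_ac)
  ultimately have "ge_S (- k) z" by simp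
  then show ?thesis by blast
qed

lemma primes_over_nonempty: "primes_over A B p \<noteq> {}"
  using ex_prime_over by (auto simp: primes_over_def)

text \<open>Ensures that \<open>real_of_ereal\<close> in \<open>sred_lin_indep\<close> does not fall
  back on its default 0 at infinite values. The upper bound comes from a single prime over
  p.\<close>

lemma w_S_finite:
  assumes "z \<noteq> 0"
  obtains r where "w_S A B p z = ereal r"
proof -
  obtain P where P: "P \<in> primes_over A B p" using primes_over_nonempty by blast
  have "w_S A B p z \<le> w_P B p P z" unfolding w_S_def using P by (rule INF_lower)
  moreover have "w_P B p P z < \<infinity>" using assms by (simp add: w_P_def)
  moreover obtain k where "ereal (of_int k) \<le> w_S A B p z" using ex_ge_S w_S_ge_iff by blast
  ultimately show ?thesis using that by (cases "w_S A B p z") auto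
qed

lemma ge_S_iff_floor:
  assumes "z \<noteq> 0"
  shows "ge_S k z \<longleftrightarrow> k \<le> \<lfloor>real_of_ereal (w_S A B p z)\<rfloor>"
proof -
  obtain r where r: "w_S A B p z = ereal r" using w_S_finite[OF assms] .
  then show ?thesis by (simp add: le_floor_iff flip: w_S_ge_iff)
qed

lemma efloor_w_S: "efloor (w_S A B p z) = \<infinity> \<or> (\<exists>k. efloor (w_S A B p z) = ereal (of_int k))"
proof (cases "z = 0")
  case True
  then have "w_S A B p z = \<infinity>"
    using primes_over_nonempty by (simp add: w_S_def w_P_def top_ereal_def[symmetric])
  then show ?thesis by (simp add: efloor_def)
next
  case False
  then obtain r where "w_S A B p z = ereal r" by (rule w_S_finite)
  then show ?thesis by (simp add: efloor_def)
qed

text \<open>Both sides of the defining equation lie in \<open>\<int> \<union> {\<infinity>}\<close>, so they can be compared by their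
  integer lower bounds.\<close>
lemma semi_reduced_iff:
  assumes I: "finite I"
  shows "semi_reduced K (w_S A B p) I b \<longleftrightarrow>
    (\<forall>c k. (\<forall>i\<in>I. c i \<in> K) \<longrightarrow> ge_S k (\<Sum>i\<in>I. c i * b i) \<longrightarrow> (\<forall>i\<in>I. ge_S k (c i * b i)))"
proof -
  let ?Z = "\<lambda>x::ereal. x = \<infinity> \<or> (\<exists>k. x = ereal (of_int k))"
  have eq_iff: "x = y \<longleftrightarrow> (\<forall>k. ereal (of_int k) \<le> x \<longleftrightarrow> ereal (of_int k) \<le> y)"
    if "?Z x" "?Z y" for x y
  proof
    assume *: "\<forall>k. ereal (of_int k) \<le> x \<longleftrightarrow> ereal (of_int k) \<le> y"
    from that show "x = y"
    proof (elim disjE exE)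
      \<comment> \<open>The integer k + 1 lies below \<infinity> but not below k.\<close>
      show ?thesis if "x = \<infinity>" "y = ereal (of_int k)" for k
        using *[rule_format, of "k + 1"] that by simp
      show ?thesis if "y = \<infinity>" "x = ereal (of_int k)" for k
        using *[rule_format, of "k + 1"] that by simp
      show ?thesis if "x = ereal (of_int k)" "y = ereal (of_int m)" for k m
        using *[rule_format, of k] *[rule_format, of m] that by simp
    qed simp
  qed simp
  have ZI: "?Z (INF i\<in>I. efloor (w_S A B p (f i)))" for f
    using I
  proof (induction I)
    case empty
    then show ?case by (simp add: top_ereal_def)
  next
    case (insert i I)
    then show ?case using efloor_w_S[of "f i"] by (auto simp: inf_min min_def)
  qed
  \<comment> \<open>A common bound of the terms always bounds the sum, so only the converse
    implication remains of the equality.\<close>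
  have "efloor (w_S A B p (\<Sum>i\<in>I. c i * b i)) = (INF i\<in>I. efloor (w_S A B p (c i * b i))) \<longleftrightarrow>
      (\<forall>k. ge_S k (\<Sum>i\<in>I. c i * b i) \<longrightarrow> (\<forall>i\<in>I. ge_S k (c i * b i)))" for c
    unfolding eq_iff[OF efloor_w_S ZI] le_INF_iff efloor_ge_iff w_S_ge_iff
    using ge_S_sum[of I _ "\<lambda>i. c i * b i"] by blast
  then show ?thesis unfolding semi_reduced_def by blast
qed

section \<open>The two implications between semi-reducedness and independence\<close>

lemma mem_scaled_iff: "x \<in> scaled \<pi> M \<longleftrightarrow> \<pi> powi (- 1) * x \<in> M"
proof
  assume "x \<in> scaled \<pi> M"
  then obtain y where "y \<in> M" "x = \<pi> * y" unfolding scaled_def by blast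
  moreover from this have "\<pi> powi (- 1) * x = y" using pi_facts by simp
  ultimately show "\<pi> powi (- 1) * x \<in> M" by (simp only:)
next
  assume "\<pi> powi (- 1) * x \<in> M"
  moreover have "x = \<pi> * (\<pi> powi (- 1) * x)" using pi_facts by simp
  ultimately show "x \<in> scaled \<pi> M" unfolding scaled_def by blast
qed

lemma sred_lin_indep_iff:
  "sred_lin_indep A B p \<pi> I b \<longleftrightarrow> (\<forall>c. (\<forall>i\<in>I. c i \<in> A) \<longrightarrow>
    ge_S 1 (\<Sum>i\<in>I. c i * \<pi> powi (- \<lfloor>real_of_ereal (w_S A B p (b i))\<rfloor>) * b i) \<longrightarrow> (\<forall>i\<in>I. c i \<in> p))"
  unfolding sred_lin_indep_def mem_scaled_iff ge_S_def ..

lemma powi_mem_K: "\<pi> powi m \<in> K"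
  using unit_powi[OF subring_K] K_inverse A_sub_K pi_facts by blast

text \<open>Semi-reducedness puts each term of a vanishing combination at level 1 separately. A
  coefficient outside p is a unit of A_p and could be removed, raising the floor k_i of b_i to k_i +
  1.\<close>

lemma sred_lin_indep_of_semi_reduced:
  assumes I: "finite I" and b: "\<forall>i\<in>I. b i \<noteq> 0" and semi: "semi_reduced K (w_S A B p) I b"
  shows "sred_lin_indep A B p \<pi> I b"
  unfolding sred_lin_indep_iff
proof (intro allI impI ballI)
  fix c i
  let ?k = "\<lambda>i. \<lfloor>real_of_ereal (w_S A B p (b i))\<rfloor>"
  assume c: "\<forall>i\<in>I. c i \<in> A" and i: "i \<in> I"
    and sum: "ge_S 1 (\<Sum>i\<in>I. c i * \<pi> powi (- ?k i) * b i)"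
  have "\<forall>i\<in>I. c i * \<pi> powi (- ?k i) \<in> K"
    using c A_sub_K powi_mem_K subring_inD(5)[OF subring_K] by blast
  then have "\<forall>i\<in>I. ge_S 1 (c i * \<pi> powi (- ?k i) * b i)"
    using semi[unfolded semi_reduced_iff[OF I], THEN spec[of _ "\<lambda>i. c i * \<pi> powi (- ?k i)"],
        THEN spec[of _ 1]] sum by simp
  then have *: "ge_S 1 (c i * (\<pi> powi (- ?k i) * b i))"
    using i by (simp add: mult.assoc)
  show "c i \<in> p"
  proof (rule ccontr)
    assume "c i \<notin> p"
    then have "c i \<in> A.V" "inverse (c i) \<in> A.V" "c i \<noteq> 0"
      using c i A.base_sub A.inverse_compl A.compl_nonzero by auto
    then have "ge_S (?k i + 1) (b i)"
      using * by (simp add: ge_S_unit_iff ge_S_shift add.commute)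
    then show False using ge_S_iff_floor b i by auto
  qed
qed

text \<open>The normalized b has floor exactly 0, so a negative power of \<pi> in c would push the
  product below level 0.\<close>

lemma coefficient_in_V:
  assumes c: "c \<in> K" and b: "b \<noteq> 0"
    and ge: "ge_S 0 (c * (\<pi> powi (- \<lfloor>real_of_ereal (w_S A B p b)\<rfloor>) * b))"
  shows "c \<in> A.V"
proof (cases "c = 0")
  case True
  then show ?thesis using A.V(1) by simp
next
  case False
  obtain m u where u: "u \<in> A.V" "inverse u \<in> A.V" "u \<noteq> 0" "c = \<pi> powi m * u"
    using uniformizerE[OF uniformizer_pi c False] by blast
  have "ge_S (0 - m + \<lfloor>real_of_ereal (w_S A B p b)\<rfloor>) b"
    using ge unfolding u(4) mult.assoc ge_S_shift ge_S_unit_iff[OF u(1-3)] by simp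
  then have "0 \<le> m" using ge_S_iff_floor[OF b] by simp
  then show ?thesis using powi_mem_V_iff[OF u(1-3)] u(4) by simp
qed

text \<open>Raise a common bound m of the terms step by step up to the bound k of the sum. While m <
  k, the sum lies one level above m, so independence forces the normalized coefficients to be
  divisible by \<pi>, and every term has level m + 1.\<close>

lemma semi_reduced_of_sred_lin_indep:
  assumes I: "finite I" and b: "\<forall>i\<in>I. b i \<noteq> 0" and indep: "sred_lin_indep A B p \<pi> I b"
  shows "semi_reduced K (w_S A B p) I b"
  unfolding semi_reduced_iff[OF I]
proof (rule allI, rule allI, rule impI, rule impI)
  fix c k
  let ?k = "\<lambda>i. \<lfloor>real_of_ereal (w_S A B p (b i))\<rfloor>"
  assume c: "\<forall>i\<in>I. c i \<in> K" and sum: "ge_S k (\<Sum>i\<in>I. c i * b i)"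
  have "\<forall>i. \<exists>k. ge_S k (c i * b i)" using ex_ge_S by blast
  then obtain k0 where "\<forall>i. ge_S (k0 i) (c i * b i)" by (rule choice[THEN exE])
  then have k0: "ge_S (k0 i) (c i * b i)" for i by blast
  \<comment> \<open>Including k makes the set nonempty and gives m0 \<le> k, so the induction from
    m0 reaches k.\<close>
  define m0 where "m0 = Min (insert k (k0 ` I))"
  have m0: "m0 \<le> k" "\<And>i. i \<in> I \<Longrightarrow> m0 \<le> k0 i" using I by (auto simp: m0_def)
  have raise: "\<forall>i\<in>I. ge_S (m + 1) (c i * b i)" if m: "m < k" "\<forall>i\<in>I. ge_S m (c i * b i)" for m
  proof -
    \<comment> \<open>The coefficient left after dividing c_i b_i by \<pi>^m and replacing b_i by
      its multiple of floor 0.\<close>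
    define \<mu> where "\<mu> i = \<pi> powi (?k i - m) * c i" for i
    have cb: "c i * b i = \<pi> powi m * (\<mu> i * (\<pi> powi (- ?k i) * b i))" for i
    proof -
      have "\<pi> powi m * \<pi> powi (?k i - m) * \<pi> powi (- ?k i) = 1"
        using pi_facts by (simp flip: power_int_add)
      then show ?thesis unfolding \<mu>_def by (metis (no_types, lifting) mult.assoc mult.commute mult_1)
    qed
    have \<mu>V: "\<mu> i \<in> A.V" if i: "i \<in> I" for i
    proof (rule coefficient_in_V[of _ "b i"])
      show "\<mu> i \<in> K" unfolding \<mu>_def using c i powi_mem_K subring_inD(5)[OF subring_K] by blast
      show "b i \<noteq> 0" using b i by blast
      show "ge_S 0 (\<mu> i * (\<pi> powi (- ?k i) * b i))"
        using m(2) i unfolding cb ge_S_shift by simp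
    qed
    \<comment> \<open>Independence is stated for coefficients in A, the \<mu> i are only in A_p. As
      s is a unit there, s \<mu>_i in p still gives \<mu>_i in the maximal ideal.\<close>
    obtain s where s: "s \<in> A" "s \<notin> p" "\<forall>i\<in>I. s * \<mu> i \<in> A"
      using A.common_denominator[OF I, of \<mu>] \<mu>V by blast
    have "(\<Sum>i\<in>I. c i * b i) = \<pi> powi m * (\<Sum>i\<in>I. \<mu> i * (\<pi> powi (- ?k i) * b i))"
      unfolding cb sum_distrib_left ..
    moreover have "ge_S (m + 1) (\<Sum>i\<in>I. c i * b i)" by (rule ge_S_mono[OF sum]) (use m(1) in simp)
    ultimately have "ge_S 1 (\<Sum>i\<in>I. \<mu> i * (\<pi> powi (- ?k i) * b i))" by (simp add: ge_S_shift)
    then have "ge_S 1 (s * (\<Sum>i\<in>I. \<mu> i * (\<pi> powi (- ?k i) * b i)))"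
      using s A.base_sub by (intro ge_S_scale) auto
    then have "ge_S 1 (\<Sum>i\<in>I. s * \<mu> i * \<pi> powi (- ?k i) * b i)"
      by (simp add: sum_distrib_left mult.assoc)
    then have sp: "\<forall>i\<in>I. s * \<mu> i \<in> p" using s(3)
      by (intro indep[unfolded sred_lin_indep_iff, THEN spec[of _ "\<lambda>i. s * \<mu> i"], THEN mp, THEN mp])
    show ?thesis
    proof
      fix i assume i: "i \<in> I"
      have "(s * \<mu> i) / s \<in> A.M" using sp s i A.maxI by blast
      then have "\<mu> i \<in> A.M" using s A.compl_nonzero by simp
      then obtain v where v: "v \<in> A.V" "\<mu> i = \<pi> * v" using max_eq by blast
      have "ge_S 0 (\<pi> powi (- ?k i) * b i)" using b i by (simp add: ge_S_shift ge_S_iff_floor)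
      then have "ge_S 0 (v * (\<pi> powi (- ?k i) * b i))" by (rule ge_S_scale[OF v(1)])
      then have "ge_S (m + 1) (\<pi> powi (m + 1) * (v * (\<pi> powi (- ?k i) * b i)))"
        unfolding ge_S_shift by simp
      also have "\<pi> powi (m + 1) * (v * (\<pi> powi (- ?k i) * b i)) = c i * b i"
        unfolding cb v using pi_facts by (simp add: power_int_add mult_ac)
      finally show "ge_S (m + 1) (c i * b i)" .
    qed
  qed
  have "\<forall>i\<in>I. ge_S j (c i * b i)" if "m0 \<le> j" "j \<le> k" for j
    using that
  proof (induction j rule: int_ge_induct)
    case base
    then show ?case using ge_S_mono k0 m0(2) by blast
  next
    case (step j)
    then show ?case using raise[of j] by simp
  qed
  then show "\<forall>i\<in>I. ge_S k (c i * b i)" using m0(1) by simp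
qed

lemma semi_reduced_iff_sred_lin_indep:
  assumes "finite I" "\<forall>i\<in>I. b i \<noteq> 0"
  shows "semi_reduced K (w_S A B p) I b \<longleftrightarrow> sred_lin_indep A B p \<pi> I b"
  using sred_lin_indep_of_semi_reduced semi_reduced_of_sred_lin_indep assms by blast

end

section \<open>Powers of the root as a spanning family\<close>

text \<open>Long division by a monic polynomial never leaves the subring. Only the remainder is
  controlled, since h f vanishes at the root.\<close>

lemma mod_monic_coeffs:
  fixes f :: "'a::field poly"
  assumes K: "subring_in K" and f: "\<And>i. coeff f i \<in> K" "lead_coeff f = 1" "1 \<le> degree f"
    and q: "\<And>i. coeff q i \<in> K"
  shows "\<exists>r h. (\<forall>i. coeff r i \<in> K) \<and> degree r < degree f \<and> q = h * f + r"
  using q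
proof (induction "degree q" arbitrary: q rule: less_induct)
  case less
  show ?case
  proof (cases "degree q < degree f")
    case True
    then show ?thesis using less.prems by (intro exI[of _ q] exI[of _ 0]) auto
  next
    case False
    define m where "m = monom (lead_coeff q) (degree q - degree f)"
    define q' where "q' = q - m * f"
    have cf: "coeff (m * f) i =
        (if i < degree q - degree f then 0 else lead_coeff q * coeff f (i - (degree q - degree f)))" for i
      by (simp add: m_def coeff_monom_mult)
    have q'K: "coeff q' i \<in> K" for i
      using less.prems f(1) subring_inD[OF K] by (simp add: q'_def cf)
    have "degree q' < degree q"
    proof (rule ccontr)
      assume "\<not> degree q' < degree q"
      then have le: "degree q \<le> degree q'" by simp
      \<comment> \<open>In degree q the leading terms cancel because f is monic; above it both q and
        m f have no terms. So q' would be 0, although q has degree at least 1.\<close>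
      have "coeff q' (degree q') = 0"
      proof (cases "degree q' = degree q")
        case True
        then show ?thesis using False f(2) by (simp add: q'_def cf)
      next
        case neq: False
        then have "degree f < degree q' - (degree q - degree f)" using le False by simp
        then show ?thesis using neq le by (simp add: q'_def cf coeff_eq_0)
      qed
      then have "degree q = 0" using le by simp
      then show False using False f(3) by simp
    qed
    then obtain r h where "\<forall>i. coeff r i \<in> K" "degree r < degree f" "q' = h * f + r"
      using less.hyps[of q'] q'K by blast
    then show ?thesis by (intro exI[of _ r] exI[of _ "h + m"]) (auto simp: q'_def algebra_simps)
  qed
qed

theorem mainTheorem7:
  fixes A p :: "'l::field set" and \<pi> \<theta> :: 'l and f :: "'l poly"
    and I :: "'i set" and b :: "'i \<Rightarrow> 'l"
  assumes dedekind: "dedekind_domain A"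
    and p_prime: "prime_ideal_in A p" and p_nonzero: "p \<noteq> {0}"
    and pi_in: "\<pi> \<in> p" and pi_val1: "\<pi> \<notin> ideal_pow A p 2"
    and f_coeffs: "\<forall>i. coeff f i \<in> A" and f_monic: "lead_coeff f = 1"
    and f_irred: "degree f \<ge> 1 \<and>
       (\<forall>g h. (\<forall>i. coeff g i \<in> frac_field A) \<and> (\<forall>i. coeff h i \<in> frac_field A) \<and> f = g * h
              \<longrightarrow> degree g = 0 \<or> degree h = 0)"
    and f_sep: "coprime f (pderiv f)"
    and root: "poly f \<theta> = 0"
    and gen: "\<forall>z. \<exists>g. (\<forall>i. coeff g i \<in> frac_field A) \<and> z = poly g \<theta>"
    and I_fin: "finite I" and b_nz: "\<forall>i\<in>I. b i \<noteq> 0"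
  shows "semi_reduced (frac_field A) (w_S A (int_closure A) p) I b \<longleftrightarrow>
         sred_lin_indep A (int_closure A) p \<pi> I b"
proof -
  interpret dedekind_prime A p \<pi>
    using dedekind p_prime p_nonzero pi_in pi_val1
    by unfold_locales (auto simp: dedekind_domain_def)
  interpret finite_extension A p \<pi> "degree f" "\<lambda>k. \<theta> ^ k"
  proof
    fix z
    obtain q where q: "\<And>i. coeff q i \<in> frac_field A" "z = poly q \<theta>" using gen by blast
    \<comment> \<open>Reducing q modulo f keeps its value at \<theta> and leaves only powers below
      the degree of f.\<close>
    obtain r h where r: "\<forall>i. coeff r i \<in> frac_field A" "degree r < degree f" "q = h * f + r"
      using mod_monic_coeffs[where f = f, OF subring_K A_sub_K[OF f_coeffs[rule_format]]
          f_monic conjunct1[OF f_irred] q(1)] by metis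
    have "z = poly r \<theta>" using q(2) r(3) root by simp
    also have "\<dots> = (\<Sum>k<degree f. coeff r k * \<theta> ^ k)"
      unfolding poly_altdef using r(2)
      by (intro sum.mono_neutral_left) (auto simp: coeff_eq_0)
    finally show "\<exists>c. (\<forall>k<degree f. c k \<in> frac_field A) \<and> z = (\<Sum>k<degree f. c k * \<theta> ^ k)"
      using r(1) by (intro exI[of _ "coeff r"]) simp
  qed
  show ?thesis by (rule semi_reduced_iff_sred_lin_indep[OF I_fin b_nz])
qed

end
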